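(* Let $f:\mathbb{R}^D\to\mathbb{R}$ be Lipschitz continuous with constant $L>0$ ($|f(x)-f(y)|\le L\|x-y\|_2$ for all $x,y$) and have effective dimension $d_e<D$, with effective subspace spanned by the columns of the orthonormal matrix $U\in\mathbb{R}^{D\times d_e}$. Let $1\le d<d_e$, let $\epsilon>0$, let $A$ be a $D\times d$ Gaussian matrix, and let $p\in\mathbb{R}^D\setminus G_\epsilon$ be a given vector. Let $r_p^{\mathrm{eff}}:=\epsilon/\left(L\|U^Tx^*-U^Tp\|\right)$, where $x^*$ is any global minimizer of $f$ over $\mathbb{R}^D$. Then $$\mathbb{P}[(\mathrm{RP}\mathcal{X})\ \text{is}\ \epsilon\text{-successful}]\ \ge\ \tau(r_p^{\mathrm{eff}},d,d_e).$$
   Context: Here $\mathcal{X}=\mathbb{R}^D$, $f^*:=\min_{x\in\mathbb{R}^D}f(x)$ (attained), $G_\epsilon:=\{x\in\mathbb{R}^D: f(x)\le f^*+\epsilon\}$. A function $f:\mathbb{R}^D\to\mathbb{R}$ has effective dimension $d_e<D$ if there exists a linear subspace $\mathcal{T}$ (the effective subspace) of dimension $d_e$ such that $f(x_\top+x_\perp)=f(x_\top)$ for all $x_\top\in\mathcal{T}$ and $x_\perp\in\mathcal{T}^\perp$, and $d_e$ is the smallest integer with this property. A Gaussian matrix has independent standard normal entries. The reduced problem $(\mathrm{RP}\mathcal{X})$ is $\min_{y\in\mathbb{R}^d}f(Ay+p)$; it is $\epsilon$-successful if there exists $y\in\mathbb{R}^d$ with $f(Ay+p)\le f^*+\epsilon$.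 For $0<r<1$ and integers $1\le d<N$, $$\tau(r,d,N):=\begin{cases}(N-1)\binom{\frac{N-2}{2}}{\frac{N-1}{2}}\displaystyle\int_0^{\arcsin(r)}\sin^{N-2}(x)\,dx & \text{if } d=1,\\[2mm] \binom{\frac{N-2}{2}}{\frac{N-d}{2}}\,r^{N-d}(1-r^2)^{\frac{d-2}{2}} & \text{if } 1<d<N,\end{cases}$$ where $\binom{i}{j}=\frac{\Gamma(i+1)}{\Gamma(j+1)\Gamma(i-j+1)}$ for real $i,j$. *)

theory Defs
  imports "HOL-Probability.Probability"
begin

text \<open>Meaningful only if the minimum is attained.\<close>

definition min_value :: "(real^'n \<Rightarrow> real) \<Rightarrow> real" where
  "min_value f = (LEAST v. v \<in> range f)"

definition near_minimizers :: "(real^'n \<Rightarrow> real) \<Rightarrow> real \<Rightarrow> (real^'n) set" where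
  "near_minimizers f \<epsilon> = {x. f x \<le> min_value f + \<epsilon>}"

definition constant_along_complement :: "(real^'n \<Rightarrow> real) \<Rightarrow> (real^'n) set \<Rightarrow> bool" where
  "constant_along_complement f T \<longleftrightarrow>
     subspace T \<and> (\<forall>x\<in>T. \<forall>y\<in>orthogonal_comp T. f (x + y) = f x)"

definition has_effective_dimension :: "(real^'n \<Rightarrow> real) \<Rightarrow> nat \<Rightarrow> bool" where
  "has_effective_dimension f k \<longleftrightarrow>
     k < CARD('n) \<and>
     (\<exists>T. constant_along_complement f T \<and> dim T = k) \<and>
     (\<forall>T. constant_along_complement f T \<longrightarrow> k \<le> dim T)"

definition effective_subspace :: "(real^'n \<Rightarrow> real) \<Rightarrow> (real^'n) set \<Rightarrow> bool" where
  "effective_subspace f T \<longleftrightarrow>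
     constant_along_complement f T \<and> has_effective_dimension f (dim T)"

definition gaussian_matrix :: "'a measure \<Rightarrow> ('a \<Rightarrow> real^'d^'n) \<Rightarrow> bool" where
  "gaussian_matrix M A \<longleftrightarrow>
     prob_space.indep_vars M (\<lambda>_. borel) (\<lambda>(i, j) \<omega>. A \<omega> $ i $ j) UNIV \<and>
     (\<forall>i j. distributed M lborel (\<lambda>\<omega>. A \<omega> $ i $ j) std_normal_density)"

definition reduced_successful ::
  "(real^'n \<Rightarrow> real) \<Rightarrow> real^'d^'n \<Rightarrow> real^'n \<Rightarrow> real \<Rightarrow> bool" where
  "reduced_successful f A p \<epsilon> \<longleftrightarrow> (\<exists>y. f (A *v y + p) \<le> min_value f + \<epsilon>)"

text \<open>Unlike \<open>gchoose\<close>, both arguments are real.\<close>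

definition real_binomial :: "real \<Rightarrow> real \<Rightarrow> real" where
  "real_binomial i j = Gamma (i + 1) / (Gamma (j + 1) * Gamma (i - j + 1))"

text \<open>Only meaningful for \<open>0 < r < 1\<close> and \<open>1 \<le> d < N\<close>; in that range the
  truncated subtractions in the natural-number exponents are exact and the base of
  \<open>powr\<close> is positive.\<close>

definition tau :: "real \<Rightarrow> nat \<Rightarrow> nat \<Rightarrow> real" where
  "tau r d N =
     (if d = 1
      then (real N - 1) * real_binomial ((real N - 2) / 2) ((real N - 1) / 2)
             * integral {0..arcsin r} (\<lambda>x. sin x ^ (N - 2))
      else real_binomial ((real N - 2) / 2) ((real N - real d) / 2)
             * r ^ (N - d) * (1 - r\<^sup>2) powr ((real d - 2) / 2))"

end

theory Submission
  imports Defs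
begin

text \<open>Write \<open>c = U\<^sup>T x\<^sup>* - U\<^sup>T p\<close> and \<open>r = \<epsilon> / (L \<parallel>c\<parallel>)\<close>. Since \<open>f\<close> factors through \<open>U\<^sup>T\<close>, the reduced problem is
  successful as soon as \<open>c\<close> is within distance \<open>r \<parallel>c\<parallel>\<close> of the range of \<open>B = U\<^sup>T A\<close>, which is again a
  Gaussian matrix. By rotation invariance the probability of this event does not depend on
  \<open>c \<noteq> 0\<close>, so \<open>c\<close> may be replaced by an independent Gaussian vector \<open>g\<close>; conditioning on \<open>B\<close>, which is
  almost surely injective, and rotating its range onto a coordinate subspace, the event says that
  the squares of \<open>N - d\<close> of the coordinates of \<open>g\<close> make up at most the fraction \<open>r\<^sup>2\<close> of the sum of
  all \<open>N\<close> squares. This fraction is Beta distributed with parameters \<open>(N - d) / 2\<close> and \<open>d / 2\<close>,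
  and \<open>\<tau>\<close> is its distribution function at \<open>r\<^sup>2\<close> for \<open>d = 1\<close>, and for \<open>d > 1\<close> the lower
  bound obtained from \<open>(1 - u) powr (d / 2 - 1) \<ge> (1 - r\<^sup>2) powr (d / 2 - 1)\<close>.\<close>

section \<open>Standard Gaussian measures on Euclidean spaces\<close>

lemma nn_integral_lborel_translation:
  fixes f :: "'a::euclidean_space \<Rightarrow> ennreal"
  assumes [measurable]: "f \<in> borel_measurable borel"
  shows "(\<integral>\<^sup>+x. f (t + x) \<partial>lborel) = (\<integral>\<^sup>+x. f x \<partial>lborel)"
proof -
  have "(\<integral>\<^sup>+x. f x \<partial>lborel) = (\<integral>\<^sup>+x. f x \<partial>(distr lborel borel ((+) t)))"
    by (simp add: lborel_distr_plus)
  also have "\<dots> = (\<integral>\<^sup>+x. f (t + x) \<partial>lborel)"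
    by (subst nn_integral_distr) auto
  finally show ?thesis by simp
qed

lemma orthogonal_transformation_borel_measurable [measurable_dest]:
  fixes f :: "'a::euclidean_space \<Rightarrow> 'a"
  assumes "orthogonal_transformation f"
  shows "f \<in> borel_measurable borel"
  by (intro borel_measurable_continuous_onI linear_continuous_on)
     (use assms orthogonal_transformation_linear linear_conv_bounded_linear in blast)

text \<open>The library's change of variables needs a well-ordered index type. Instead, the image of
  Lebesgue measure is translation invariant, and integrating \<open>g (x - y) * h x\<close>, for \<open>g\<close> the
  indicator of the unit ball, in both orders identifies it.\<close>

lemma lborel_distr_orthogonal:
  fixes f :: "'a::euclidean_space \<Rightarrow> 'a"
  assumes f: "orthogonal_transformation f"
  shows "distr lborel borel f = lborel"
proof (rule measure_eqI)
  note [measurable] = orthogonal_transformation_borel_measurable[OF f]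
  have lin: "linear f" using f by (rule orthogonal_transformation_linear)
  \<comment> \<open>The unit ball is invariant under \<open>f\<close> and under negation and has
    positive finite volume, so the integral of \<open>g\<close> can be cancelled at the end.\<close>
  define g :: "'a \<Rightarrow> ennreal" where "g = indicator (ball 0 1)"
  have [measurable]: "g \<in> borel_measurable borel"
    unfolding g_def by (intro borel_measurable_indicator) simp
  have gf: "g (f x) = g x" for x
    by (simp add: g_def indicator_def orthogonal_transformation_norm[OF f])
  have gm: "g (- x) = g x" for x by (simp add: g_def indicator_def)
  have gball: "(\<integral>\<^sup>+x. g x \<partial>lborel) = emeasure lborel (ball 0 1 :: 'a set)"
    by (simp add: g_def)
  fix A assume "A \<in> sets (distr lborel borel f)"
  then have [measurable]: "A \<in> sets borel" by simp
  define h :: "'a \<Rightarrow> ennreal" where "h = indicator A"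
  have [measurable]: "h \<in> borel_measurable borel" unfolding h_def by measurable
  \<comment> \<open>Surjectivity of \<open>f\<close> turns a shift of the argument of
    \<open>h\<close> into a shift of the integration variable:
    \<open>x + f y = f (z + y)\<close>.\<close>
  have tr: "(\<integral>\<^sup>+y. h (f y) \<partial>lborel) = (\<integral>\<^sup>+y. h (x + f y) \<partial>lborel)" for x
  proof -
    obtain z where z: "x = f z" using orthogonal_transformation_surj[OF f] by (metis surjD)
    have "(\<integral>\<^sup>+y. h (x + f y) \<partial>lborel) = (\<integral>\<^sup>+y. h (f (z + y)) \<partial>lborel)"
      by (simp add: z linear_add[OF lin])
    also have "\<dots> = (\<integral>\<^sup>+y. h (f y) \<partial>lborel)"
      by (rule nn_integral_lborel_translation[of "\<lambda>y. h (f y)"]) measurable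
    finally show ?thesis by simp
  qed
  have "(\<integral>\<^sup>+x. g x \<partial>lborel) * (\<integral>\<^sup>+y. h (f y) \<partial>lborel) = (\<integral>\<^sup>+x. g x * (\<integral>\<^sup>+y. h (f y) \<partial>lborel) \<partial>lborel)"
    by (simp add: nn_integral_multc)
  also have "\<dots> = (\<integral>\<^sup>+x. \<integral>\<^sup>+y. g x * h (x + f y) \<partial>lborel \<partial>lborel)"
    by (intro nn_integral_cong) (subst tr, subst nn_integral_cmult, auto)
  also have "\<dots> = (\<integral>\<^sup>+y. \<integral>\<^sup>+x. g x * h (x + f y) \<partial>lborel \<partial>lborel)"
    by (rule lborel_pair.Fubini') measurable
  also have "\<dots> = (\<integral>\<^sup>+y. \<integral>\<^sup>+x. g (x - f y) * h x \<partial>lborel \<partial>lborel)"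
  proof (rule nn_integral_cong)
    fix y
    show "(\<integral>\<^sup>+x. g x * h (x + f y) \<partial>lborel) = (\<integral>\<^sup>+x. g (x - f y) * h x \<partial>lborel)"
      using nn_integral_lborel_translation[of "\<lambda>x. g x * h (x + f y)" "- f y"] by (simp)
  qed
  also have "\<dots> = (\<integral>\<^sup>+x. \<integral>\<^sup>+y. g (x - f y) * h x \<partial>lborel \<partial>lborel)"
    by (rule lborel_pair.Fubini') measurable
  also have "\<dots> = (\<integral>\<^sup>+x. (\<integral>\<^sup>+x. g x \<partial>lborel) * h x \<partial>lborel)"
  proof (rule nn_integral_cong)
    fix x
    \<comment> \<open>With \<open>x = f z\<close>, the symmetries of \<open>g\<close> reduce
      \<open>g (x - f y)\<close> to a translate of \<open>g\<close> in \<open>y\<close>, whose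
      integral no longer depends on \<open>x\<close>.\<close>
    obtain z where z: "x = f z" using orthogonal_transformation_surj[OF f] by (metis surjD)
    have "(\<integral>\<^sup>+y. g (x - f y) * h x \<partial>lborel) = (\<integral>\<^sup>+y. g (x - f y) \<partial>lborel) * h x"
      by (simp add: nn_integral_multc)
    also have "(\<integral>\<^sup>+y. g (x - f y) \<partial>lborel) = (\<integral>\<^sup>+y. g (- z + y) \<partial>lborel)"
    proof (rule nn_integral_cong)
      fix y
      have "g (x - f y) = g (f (z - y))" by (simp add: z linear_diff[OF lin])
      also have "\<dots> = g (- (z - y))" by (simp only: gf gm)
      finally show "g (x - f y) = g (- z + y)" by simp
    qed
    also have "\<dots> = (\<integral>\<^sup>+y. g y \<partial>lborel)" by (rule nn_integral_lborel_translation) measurable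
    finally show "(\<integral>\<^sup>+y. g (x - f y) * h x \<partial>lborel) = (\<integral>\<^sup>+x. g x \<partial>lborel) * h x" .
  qed
  also have "\<dots> = (\<integral>\<^sup>+x. g x \<partial>lborel) * (\<integral>\<^sup>+x. h x \<partial>lborel)"
    by (simp add: nn_integral_cmult)
  finally have eq: "(\<integral>\<^sup>+x. g x \<partial>lborel) * (\<integral>\<^sup>+y. h (f y) \<partial>lborel) = (\<integral>\<^sup>+x. g x \<partial>lborel) * (\<integral>\<^sup>+x. h x \<partial>lborel)" .
  have "(\<integral>\<^sup>+y. h (f y) \<partial>lborel) = (\<integral>\<^sup>+x. h x \<partial>lborel)"
    using eq unfolding gball emeasure_ball[OF zero_le_one]
    by (subst (asm) ennreal_mult_cancel_left) (use unit_ball_vol_pos[of "real DIM('a)"] in \<open>auto simp: ennreal_eq_0_iff simp del: unit_ball_vol_pos\<close>)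
  moreover have "(\<integral>\<^sup>+y. h (f y) \<partial>lborel) = emeasure (distr lborel borel f) A"
    by (subst nn_integral_distr[symmetric, of _ _ borel]) (auto simp: h_def)
  ultimately show "emeasure (distr lborel borel f) A = emeasure lborel A"
    by (simp add: h_def)
qed simp

section \<open>The standard Gaussian measure: coordinates, rotation invariance, marginals\<close>

text \<open>A density built from \<open>Basis\<close> covers vectors, matrices and pairs at once, so
  a random matrix can be treated as a vector.\<close>

definition std_gaussian :: "'a::euclidean_space measure" where
  "std_gaussian = density lborel (\<lambda>x. ennreal (\<Prod>b\<in>Basis. std_normal_density (x \<bullet> b)))"

abbreviation std_normal :: "real measure" where
  "std_normal \<equiv> density lborel (\<lambda>x. ennreal (std_normal_density x))"

lemma sets_std_gaussian [simp, measurable_cong]: "sets std_gaussian = sets borel"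
  by (simp add: std_gaussian_def)

lemma space_std_gaussian [simp]: "space std_gaussian = UNIV"
  by (simp add: std_gaussian_def)

interpretation std_normal: prob_space std_normal
  by (rule prob_space_normal_density) simp

interpretation std_normal_PiM: product_prob_space "\<lambda>_::'i. std_normal" I for I
  ..

text \<open>A product measure is determined by boxes, on which both the density and the indicator
  factor over the coordinates. The index set is free so that matrix entries indexed by pairs and
  basis vectors split into blocks are both covered.\<close>

lemma std_gaussian_coordinates:
  fixes \<beta> :: "'i \<Rightarrow> 'a::euclidean_space"
  assumes \<beta>: "bij_betw \<beta> I Basis"
  shows "distr std_gaussian (PiM I (\<lambda>_. borel)) (\<lambda>x. \<lambda>i\<in>I. x \<bullet> \<beta> i) = PiM I (\<lambda>_. std_normal)"
proof (rule std_normal_PiM.PiM_eqI)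
  show fin: "finite I" using \<beta> bij_betw_finite finite_Basis by blast
  show "sets (distr std_gaussian (PiM I (\<lambda>_. borel)) (\<lambda>x. \<lambda>i\<in>I. x \<bullet> \<beta> i)) = sets (PiM I (\<lambda>_. std_normal))"
    by (simp cong: sets_PiM_cong)
  fix A :: "'i \<Rightarrow> real set" assume A: "\<And>i. i \<in> I \<Longrightarrow> A i \<in> sets std_normal"
  define \<gamma> where "\<gamma> = the_inv_into I \<beta>"
  have \<gamma>: "\<gamma> (\<beta> i) = i" if "i \<in> I" for i
    using \<beta> that unfolding \<gamma>_def bij_betw_def by (simp add: the_inv_into_f_f)
  have \<gamma>': "\<gamma> b \<in> I" "\<beta> (\<gamma> b) = b" if "b \<in> Basis" for b
    using \<beta> that unfolding \<gamma>_def bij_betw_def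
    by (auto simp add: the_inv_into_into f_the_inv_into_f)
  have [measurable]: "A (\<gamma> b) \<in> sets borel" if "b \<in> Basis" for b
    using A \<gamma>'(1)[OF that] by auto
  have [measurable]: "PiE I A \<in> sets (PiM I (\<lambda>_. borel))"
    using A fin by (intro sets_PiM_I_finite) auto
  have "emeasure (distr std_gaussian (PiM I (\<lambda>_. borel)) (\<lambda>x. \<lambda>i\<in>I. x \<bullet> \<beta> i)) (PiE I A)
      = (\<integral>\<^sup>+z. indicator (PiE I A) z \<partial>(distr std_gaussian (PiM I (\<lambda>_. borel)) (\<lambda>x. \<lambda>i\<in>I. x \<bullet> \<beta> i)))"
    by (subst nn_integral_indicator) auto
  also have "\<dots> = (\<integral>\<^sup>+x. indicator (PiE I A) (\<lambda>i\<in>I. x \<bullet> \<beta> i) \<partial>std_gaussian)"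
    by (subst nn_integral_distr) auto
  also have "\<dots> = (\<integral>\<^sup>+x. ennreal (\<Prod>b\<in>Basis. std_normal_density (x \<bullet> b)) * indicator (PiE I A) (\<lambda>i\<in>I. x \<bullet> \<beta> i) \<partial>lborel)"
    unfolding std_gaussian_def
    by (subst nn_integral_density) auto
  also have "\<dots> = (\<integral>\<^sup>+x. (\<Prod>b\<in>Basis. ennreal (std_normal_density (x \<bullet> b)) * indicator (A (\<gamma> b)) (x \<bullet> b)) \<partial>(lborel :: 'a measure))"
  proof (rule nn_integral_cong)
    fix x :: 'a
    have "(indicator (PiE I A) (\<lambda>i\<in>I. x \<bullet> \<beta> i) :: ennreal) = (\<Prod>i\<in>I. indicator (A i) (x \<bullet> \<beta> i))"
      using fin by (auto simp: indicator_def PiE_iff)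
    also have "\<dots> = (\<Prod>b\<in>Basis. indicator (A (\<gamma> b)) (x \<bullet> b))"
      using \<beta> \<gamma> by (subst prod.reindex_bij_betw[OF \<beta>, symmetric]) (auto intro!: prod.cong)
    finally show "ennreal (\<Prod>b\<in>Basis. std_normal_density (x \<bullet> b)) * indicator (PiE I A) (\<lambda>i\<in>I. x \<bullet> \<beta> i)
      = (\<Prod>b\<in>Basis. ennreal (std_normal_density (x \<bullet> b)) * indicator (A (\<gamma> b)) (x \<bullet> b))"
      by (simp add: prod.distrib prod_ennreal)
  qed
  also have "\<dots> = (\<Prod>b\<in>(Basis::'a set). \<integral>\<^sup>+x. ennreal (std_normal_density x) * indicator (A (\<gamma> b)) x \<partial>lborel)"
    by (subst nn_integral_lborel_prod) auto
  also have "\<dots> = (\<Prod>b\<in>(Basis::'a set). emeasure std_normal (A (\<gamma> b)))"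
    by (intro prod.cong refl) (subst emeasure_density, auto)
  also have "\<dots> = (\<Prod>i\<in>I. emeasure std_normal (A i))"
    by (subst prod.reindex_bij_betw[OF \<beta>, symmetric]) (auto simp: \<gamma> intro!: prod.cong)
  finally show "emeasure (distr std_gaussian (PiM I (\<lambda>_. borel)) (\<lambda>x. \<lambda>i\<in>I. x \<bullet> \<beta> i)) (PiE I A) = (\<Prod>i\<in>I. emeasure std_normal (A i))" .
qed

lemma prob_space_std_gaussian: "prob_space (std_gaussian :: 'a::euclidean_space measure)"
proof -
  interpret P: prob_space "distr (std_gaussian :: 'a measure) (PiM Basis (\<lambda>_. borel)) (\<lambda>x. \<lambda>i\<in>Basis. x \<bullet> i)"
    using std_gaussian_coordinates[of id "Basis :: 'a set"]
    by (auto intro: prob_space_PiM std_normal.prob_space_axioms)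
  have "emeasure (distr (std_gaussian :: 'a measure) (PiM Basis (\<lambda>_. borel)) (\<lambda>x. \<lambda>i\<in>Basis. x \<bullet> i)) (space (distr (std_gaussian :: 'a measure) (PiM Basis (\<lambda>_. borel)) (\<lambda>x. \<lambda>i\<in>Basis. x \<bullet> i)))
     = emeasure (std_gaussian :: 'a measure) UNIV"
    by (subst emeasure_distr) (auto intro!: arg_cong[where f = "emeasure _"] simp: space_PiM)
  then show ?thesis using P.emeasure_space_1 by (intro prob_spaceI) simp
qed

interpretation std_gaussian: prob_space "std_gaussian :: 'a::euclidean_space measure"
  by (rule prob_space_std_gaussian)

text \<open>The density depends on the norm alone and Lebesgue measure is invariant, so an
  orthogonal map changes neither.\<close>

lemma distr_std_gaussian_orthogonal:
  fixes f :: "'a::euclidean_space \<Rightarrow> 'a"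
  assumes f: "orthogonal_transformation f"
  shows "distr std_gaussian borel f = std_gaussian"
proof (rule measure_eqI)
  note [measurable] = orthogonal_transformation_borel_measurable[OF f]
  define \<phi> :: "'a \<Rightarrow> ennreal" where "\<phi> x = ennreal (\<Prod>b\<in>Basis. std_normal_density (x \<bullet> b))" for x
  have [measurable]: "\<phi> \<in> borel_measurable borel" unfolding \<phi>_def by measurable
  have "\<phi> x = ennreal ((1 / sqrt (2 * pi)) ^ DIM('a) * exp (- (norm x)\<^sup>2 / 2))" for x
  proof -
    have "(norm x)\<^sup>2 = (\<Sum>b\<in>Basis. (x \<bullet> b)\<^sup>2)"
      by (subst power2_norm_eq_inner, subst euclidean_inner) (simp add: power2_eq_square)
    then have "exp (- (norm x)\<^sup>2 / 2) = (\<Prod>b\<in>Basis. exp (- (x \<bullet> b)\<^sup>2 / 2))"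
      by (simp add: exp_sum[symmetric] sum_negf[symmetric] sum_divide_distrib)
    then show ?thesis
      by (simp only: \<phi>_def std_normal_density_def prod.distrib prod_constant)
  qed
  then have \<phi>: "\<phi> (f x) = \<phi> x" for x
    by (simp add: orthogonal_transformation_norm[OF f])
  fix A assume "A \<in> sets (distr std_gaussian borel f)"
  then have [measurable]: "A \<in> sets borel" by simp
  have "emeasure (distr std_gaussian borel f) A = emeasure std_gaussian (f -` A)"
    by (subst emeasure_distr) auto
  also have "\<dots> = (\<integral>\<^sup>+x. \<phi> x * indicator (f -` A) x \<partial>lborel)"
    unfolding std_gaussian_def \<phi>_def[symmetric]
    by (subst emeasure_density) (auto intro: measurable_sets_borel[of f borel])
  also have "\<dots> = (\<integral>\<^sup>+x. \<phi> (f x) * indicator A (f x) \<partial>lborel)"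
    by (simp add: \<phi> indicator_def)
  also have "\<dots> = (\<integral>\<^sup>+x. \<phi> x * indicator A x \<partial>(distr lborel borel f))"
    by (subst nn_integral_distr) auto
  also have "\<dots> = emeasure std_gaussian A"
    unfolding lborel_distr_orthogonal[OF f] std_gaussian_def \<phi>_def[symmetric]
    by (subst emeasure_density) auto
  finally show "emeasure (distr std_gaussian borel f) A = emeasure std_gaussian A" .
qed simp

lemma fst_snd_borel_measurable [measurable]:
  "fst \<in> borel_measurable (borel :: ('a::euclidean_space \<times> 'b::euclidean_space) measure)"
  "snd \<in> borel_measurable (borel :: ('a::euclidean_space \<times> 'b::euclidean_space) measure)"
  by (auto intro!: borel_measurable_continuous_onI continuous_intros)

lemma std_gaussian_prod:
  "std_gaussian \<Otimes>\<^sub>M std_gaussian = (std_gaussian :: ('a::euclidean_space \<times> 'b::euclidean_space) measure)"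
proof -
  have fs: "sigma_finite_measure (density lborel (\<lambda>x::'b. ennreal (\<Prod>b\<in>Basis. std_normal_density (x \<bullet> b))))"
    unfolding std_gaussian_def[symmetric] by (rule std_gaussian.sigma_finite_measure)
  have eq: "(\<Prod>b\<in>Basis. std_normal_density (x \<bullet> b)) * (\<Prod>b\<in>Basis. std_normal_density (y \<bullet> b))
      = (\<Prod>b\<in>Basis. std_normal_density ((x, y) \<bullet> b))" for x :: 'a and y :: 'b
    unfolding Basis_prod_def
    by (subst prod.union_disjoint) (auto simp: prod.reindex inj_on_def)
  show ?thesis
    unfolding std_gaussian_def
    by (subst pair_measure_density)
       (auto simp: fs lborel_prod lborel.sigma_finite_measure_axioms eq[symmetric] prod_nonneg ennreal_mult'
             case_prod_beta intro!: density_cong)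
qed

lemma distr_std_gaussian_snd:
  "distr (std_gaussian :: ('a::euclidean_space \<times> 'b::euclidean_space) measure) borel snd = std_gaussian"
proof (rule measure_eqI)
  fix A :: "'b set" assume "A \<in> sets (distr (std_gaussian :: ('a \<times> 'b) measure) borel snd)"
  then have [measurable]: "A \<in> sets borel" by simp
  have "emeasure (distr (std_gaussian :: ('a \<times> 'b) measure) borel snd) A = emeasure ((std_gaussian :: 'a measure) \<Otimes>\<^sub>M (std_gaussian :: 'b measure)) (UNIV \<times> A)"
    by (subst emeasure_distr) (auto simp: std_gaussian_prod vimage_fst vimage_snd)
  also have "\<dots> = emeasure std_gaussian A"
    by (subst std_gaussian.emeasure_pair_measure_Times) (auto simp: std_gaussian.emeasure_space_1[simplified])
  finally show "emeasure (distr (std_gaussian :: ('a \<times> 'b) measure) borel snd) A = emeasure std_gaussian A" .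
qed simp

lemma distr_std_gaussian_fst:
  "distr (std_gaussian :: ('a::euclidean_space \<times> 'b::euclidean_space) measure) borel fst = std_gaussian"
proof (rule measure_eqI)
  fix A :: "'a set" assume "A \<in> sets (distr (std_gaussian :: ('a \<times> 'b) measure) borel fst)"
  then have [measurable]: "A \<in> sets borel" by simp
  have "emeasure (distr (std_gaussian :: ('a \<times> 'b) measure) borel fst) A = emeasure ((std_gaussian :: 'a measure) \<Otimes>\<^sub>M (std_gaussian :: 'b measure)) (A \<times> UNIV)"
    by (subst emeasure_distr) (auto simp: std_gaussian_prod vimage_fst vimage_snd)
  also have "\<dots> = emeasure std_gaussian A"
    by (subst std_gaussian.emeasure_pair_measure_Times) (auto simp: std_gaussian.emeasure_space_1[simplified])
  finally show "emeasure (distr (std_gaussian :: ('a \<times> 'b) measure) borel fst) A = emeasure std_gaussian A" .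
qed simp

text \<open>By \<open>adj\<close> and \<open>TT'\<close>, the map \<open>T'\<close> is the adjoint
  and an isometric right inverse of \<open>T\<close>. After adjoining an independent Gaussian vector
  in the target space, \<open>T\<close> becomes the second component of an orthogonal map, so its
  law is a marginal of an invariant measure.\<close>

lemma distr_std_gaussian_coisometry:
  fixes T :: "'a::euclidean_space \<Rightarrow> 'b::euclidean_space" and T' :: "'b \<Rightarrow> 'a"
  assumes T: "linear T" and T': "linear T'"
    and adj: "\<And>x z. T x \<bullet> z = x \<bullet> T' z" and TT': "\<And>z. T (T' z) = z"
  shows "distr std_gaussian borel T = std_gaussian"
proof -
  \<comment> \<open>A swap: the part \<open>T' (T x)\<close> of the first component \<open>x\<close>
    is replaced by \<open>T'\<close> of the second component, which in turn receives
    \<open>T x\<close>.\<close>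
  define F :: "'a \<times> 'b \<Rightarrow> 'a \<times> 'b" where "F = (\<lambda>p. (fst p - T' (T (fst p)) + T' (snd p), T (fst p)))"
  have Tm [measurable]: "T \<in> borel_measurable borel"
    using T by (simp add: borel_measurable_continuous_onI linear_continuous_on linear_conv_bounded_linear)
  have linF: "linear F"
    by (intro linearI) (auto simp: F_def linear_add[OF T] linear_add[OF T'] linear_scale[OF T] linear_scale[OF T'] algebra_simps)
  have "F p \<bullet> F q = p \<bullet> q" for p q
  proof -
    have a: "T' z \<bullet> x = T x \<bullet> z" for x z by (metis adj inner_commute)
    show ?thesis
      by (cases p; cases q)
         (simp add: F_def inner_add_left inner_add_right inner_diff_left inner_diff_right adj[symmetric] a TT'
            linear_diff[OF T] linear_add[OF T], simp add: inner_commute)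
  qed
  then have orth: "orthogonal_transformation F"
    using linF by (auto simp: orthogonal_transformation_def)
  note [measurable] = orthogonal_transformation_borel_measurable[OF orth]
  have "distr (std_gaussian :: 'a measure) borel T = distr (distr (std_gaussian :: ('a \<times> 'b) measure) borel fst) borel T"
    by (simp add: distr_std_gaussian_fst)
  also have "\<dots> = distr (std_gaussian :: ('a \<times> 'b) measure) borel (T \<circ> fst)"
    by (rule distr_distr) simp_all
  also have "T \<circ> fst = snd \<circ> F" by (auto simp: F_def)
  also have "distr (std_gaussian :: ('a \<times> 'b) measure) borel (snd \<circ> F) = distr (distr std_gaussian borel F) borel snd"
    by (rule distr_distr[symmetric]) simp_all
  also have "\<dots> = std_gaussian"
    by (simp add: distr_std_gaussian_orthogonal[OF orth] distr_std_gaussian_snd)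
  finally show ?thesis .
qed

section \<open>Gamma and Beta distributions\<close>

text \<open>The rate is fixed at 1, which makes half the square of a standard normal variable, not
  the square itself, the convenient variable.\<close>

definition gamma_density :: "real \<Rightarrow> real \<Rightarrow> real" where
  "gamma_density a t = (if t > 0 then t powr (a - 1) * exp (- t) / Gamma a else 0)"

definition beta_density :: "real \<Rightarrow> real \<Rightarrow> real \<Rightarrow> real" where
  "beta_density a b u = (if 0 < u \<and> u < 1 then u powr (a - 1) * (1 - u) powr (b - 1) / Beta a b else 0)"

lemma gamma_density_measurable [measurable]: "gamma_density a \<in> borel_measurable borel"
  unfolding gamma_density_def by measurable

lemma beta_density_measurable [measurable]: "beta_density a b \<in> borel_measurable borel"
  unfolding beta_density_def by measurable

lemma gamma_density_nonneg: "a > 0 \<Longrightarrow> gamma_density a t \<ge> 0"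
  by (simp add: gamma_density_def Gamma_real_pos less_imp_le)

lemma Beta_real_pos: "a > 0 \<Longrightarrow> b > 0 \<Longrightarrow> Beta a b > (0::real)"
  by (simp add: Beta_def Gamma_real_pos)

lemma beta_density_nonneg: "a > 0 \<Longrightarrow> b > 0 \<Longrightarrow> beta_density a b u \<ge> 0"
  using Beta_real_pos[of a b] by (simp add: beta_density_def)

lemma nn_integral_gamma_density:
  assumes "a > 0"
  shows "(\<integral>\<^sup>+t. ennreal (gamma_density a t) \<partial>lborel) = 1"
proof -
  have "(\<integral>\<^sup>+t. ennreal (gamma_density a t) \<partial>lborel)
      = (\<integral>\<^sup>+t. ennreal (1 / Gamma a) * ennreal (indicator {0..} t * t powr (a - 1) / exp t) \<partial>lborel)"
  proof (rule nn_integral_cong_AE)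
    have "AE t in lborel. t \<noteq> (0::real)" by (rule AE_lborel_singleton)
    then show "AE t in lborel. ennreal (gamma_density a t) =
        ennreal (1 / Gamma a) * ennreal (indicator {0..} t * t powr (a - 1) / exp t)"
      by eventually_elim
         (auto simp: gamma_density_def indicator_def exp_minus field_simps ennreal_mult'[symmetric]
            Gamma_real_pos[OF assms] less_imp_le)
  qed
  also have "\<dots> = ennreal (1 / Gamma a) * ennreal (Gamma a)"
    by (subst nn_integral_cmult) (auto simp: Gamma_conv_nn_integral_real[OF assms])
  also have "\<dots> = 1"
    using Gamma_real_pos[OF assms] by (simp add: ennreal_mult'[symmetric])
  finally show ?thesis .
qed

lemma nn_integral_beta_density:
  assumes "a > 0" "b > 0"
  shows "(\<integral>\<^sup>+u. ennreal (beta_density a b u) \<partial>lborel) = 1"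
proof -
  have "((\<lambda>t. t powr (a - 1) * (1 - t) powr (b - 1)) has_integral Beta a b) {0<..<1}"
    using has_integral_Beta_real[OF assms] by (simp add: has_integral_Icc_iff_Ioo)
  from has_integral_divide[OF this, of "Beta a b"]
  have "((\<lambda>t. t powr (a - 1) * (1 - t) powr (b - 1) / Beta a b) has_integral 1) {0<..<1}"
    using Beta_real_pos[OF assms] by simp
  from nn_integral_has_integral_lebesgue[OF _ this]
  have "(\<integral>\<^sup>+t. ennreal (indicator {0<..<1} t * (t powr (a - 1) * (1 - t) powr (b - 1) / Beta a b)) \<partial>lborel) = ennreal 1"
    using Beta_real_pos[OF assms] by simp
  also have "(\<lambda>t. indicator {0<..<1} t * (t powr (a - 1) * (1 - t) powr (b - 1) / Beta a b)) = beta_density a b"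
    by (auto simp: beta_density_def indicator_def fun_eq_iff)
  finally show ?thesis by simp
qed

text \<open>The leading \<open>t\<close> is the Jacobian of \<open>(t, u)\<close> to
  \<open>(t * u, t * (1 - u))\<close>. The exponentials combine to \<open>exp (- t)\<close>, and the
  constants through \<open>Beta a b = Gamma a * Gamma b / Gamma (a + b)\<close>.\<close>

lemma gamma_gamma_density:
  assumes "a > 0" "b > 0" "t > 0"
  shows "t * (gamma_density a (t * u) * gamma_density b (t * (1 - u)))
      = gamma_density (a + b) t * beta_density a b u"
proof (cases "0 < u \<and> u < 1")
  case True
  have "t * (gamma_density a (t * u) * gamma_density b (t * (1 - u)))
     = (t powr 1 * t powr (a - 1) * t powr (b - 1)) * (exp (- (t * u)) * exp (- (t * (1 - u))))
       * (u powr (a - 1) * (1 - u) powr (b - 1)) / (Gamma a * Gamma b)"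
    using True assms by (simp add: gamma_density_def powr_mult)
  also have "t powr 1 * t powr (a - 1) * t powr (b - 1) = t powr (a + b - 1)"
    unfolding powr_add[symmetric] by (simp add: algebra_simps)
  also have "exp (- (t * u)) * exp (- (t * (1 - u))) = exp (- t)"
    unfolding exp_add[symmetric] by (simp add: algebra_simps)
  also have "t powr (a + b - 1) * exp (- t) * (u powr (a - 1) * (1 - u) powr (b - 1)) / (Gamma a * Gamma b)
     = gamma_density (a + b) t * beta_density a b u"
    using True assms Gamma_real_pos[of "a + b"] less_imp_neq[of 0 "Gamma (a + b)"]
    by (simp add: gamma_density_def beta_density_def Beta_def)
  finally show ?thesis .
next
  case False
  then show ?thesis
    using assms by (auto simp: gamma_density_def beta_density_def zero_less_mult_iff)
qed

text \<open>For independent Gamma variables \<open>X\<close> and \<open>Y\<close>, the sum \<open>X + Y\<close> and the ratio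
  \<open>X / (X + Y)\<close> are independent, Gamma and Beta distributed.\<close>

lemma nn_integral_gamma_gamma:
  assumes a: "a > 0" and b: "b > 0"
    and [measurable]: "(\<lambda>(x, y). h x y) \<in> borel_measurable (borel \<Otimes>\<^sub>M borel)"
  shows "(\<integral>\<^sup>+x. \<integral>\<^sup>+y. h x y * ennreal (gamma_density a x * gamma_density b y) \<partial>lborel \<partial>lborel)
      = (\<integral>\<^sup>+t. \<integral>\<^sup>+u. h (t * u) (t * (1 - u)) * ennreal (gamma_density (a + b) t * beta_density a b u) \<partial>lborel \<partial>lborel)"
proof -
  \<comment> \<open>The change of variables proceeds one coordinate at a time:
    \<open>y = t - x\<close> for fixed \<open>x\<close>, then, after exchanging the integrals,
    \<open>x = t * u\<close> for fixed \<open>t > 0\<close>.\<close>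
  have "(\<integral>\<^sup>+x. \<integral>\<^sup>+y. h x y * ennreal (gamma_density a x * gamma_density b y) \<partial>lborel \<partial>lborel)
     = (\<integral>\<^sup>+x. \<integral>\<^sup>+t. h x (t - x) * ennreal (gamma_density a x * gamma_density b (t - x)) \<partial>lborel \<partial>lborel)"
  proof (rule nn_integral_cong)
    fix x
    show "(\<integral>\<^sup>+y. h x y * ennreal (gamma_density a x * gamma_density b y) \<partial>lborel)
       = (\<integral>\<^sup>+t. h x (t - x) * ennreal (gamma_density a x * gamma_density b (t - x)) \<partial>lborel)"
      by (subst nn_integral_real_affine[where t = "- x" and c = 1]) auto
  qed
  also have "\<dots> = (\<integral>\<^sup>+t. \<integral>\<^sup>+x. h x (t - x) * ennreal (gamma_density a x * gamma_density b (t - x)) \<partial>lborel \<partial>lborel)"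
    by (rule lborel_pair.Fubini') measurable
  also have "\<dots> = (\<integral>\<^sup>+t. \<integral>\<^sup>+u. h (t * u) (t * (1 - u)) * ennreal (gamma_density (a + b) t * beta_density a b u) \<partial>lborel \<partial>lborel)"
  proof (rule nn_integral_cong)
    fix t :: real
    show "(\<integral>\<^sup>+x. h x (t - x) * ennreal (gamma_density a x * gamma_density b (t - x)) \<partial>lborel)
        = (\<integral>\<^sup>+u. h (t * u) (t * (1 - u)) * ennreal (gamma_density (a + b) t * beta_density a b u) \<partial>lborel)"
    proof (cases "t > 0")
      case True
      have "(\<integral>\<^sup>+x. h x (t - x) * ennreal (gamma_density a x * gamma_density b (t - x)) \<partial>lborel)
         = (\<integral>\<^sup>+u. ennreal t * (h (t * u) (t - t * u) * ennreal (gamma_density a (t * u) * gamma_density b (t - t * u))) \<partial>lborel)"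
        using True by (subst nn_integral_real_affine[where t = 0 and c = t]) (auto simp: nn_integral_cmult)
      also have "\<dots> = (\<integral>\<^sup>+u. h (t * u) (t * (1 - u)) * ennreal (gamma_density (a + b) t * beta_density a b u) \<partial>lborel)"
        using True unfolding gamma_gamma_density[OF a b True, symmetric]
        by (intro nn_integral_cong) (simp add: ennreal_mult' right_diff_distrib ac_simps)
      finally show ?thesis .
    next
      \<comment> \<open>For \<open>t \<le> 0\<close> the numbers \<open>x\<close> and
        \<open>t - x\<close> are never both positive, so both integrands vanish.\<close>
      case False
      then have z: "gamma_density a x * gamma_density b (t - x) = 0" "gamma_density (a + b) t = 0" for x
        by (auto simp: gamma_density_def)
      show ?thesis by (simp only: z mult_zero_left ennreal_0 mult_zero_right)
    qed
  qed
  finally show ?thesis .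
qed

text \<open>Here the integrand depends only on \<open>t * u + t * (1 - u) = t\<close>, so the Beta
  factor integrates to 1. The nested form matches the induction step for sums of squares.\<close>

lemma nn_integral_gamma_sum:
  assumes a: "a > 0" and b: "b > 0" and [measurable]: "h \<in> borel_measurable borel"
  shows "(\<integral>\<^sup>+x. (\<integral>\<^sup>+y. h (x + y) * ennreal (gamma_density b y) \<partial>lborel) * ennreal (gamma_density a x) \<partial>lborel)
      = (\<integral>\<^sup>+t. h t * ennreal (gamma_density (a + b) t) \<partial>lborel)"
proof -
  have "(\<integral>\<^sup>+x. (\<integral>\<^sup>+y. h (x + y) * ennreal (gamma_density b y) \<partial>lborel) * ennreal (gamma_density a x) \<partial>lborel)
     = (\<integral>\<^sup>+x. \<integral>\<^sup>+y. h (x + y) * ennreal (gamma_density a x * gamma_density b y) \<partial>lborel \<partial>lborel)"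
    by (intro nn_integral_cong, subst nn_integral_multc[symmetric])
       (auto simp: ennreal_mult' gamma_density_nonneg[OF a] ac_simps)
  also have "\<dots> = (\<integral>\<^sup>+t. \<integral>\<^sup>+u. h (t * u + t * (1 - u)) * ennreal (gamma_density (a + b) t * beta_density a b u) \<partial>lborel \<partial>lborel)"
    by (rule nn_integral_gamma_gamma[OF a b]) measurable
  also have "\<dots> = (\<integral>\<^sup>+t. h t * ennreal (gamma_density (a + b) t) \<partial>lborel)"
  proof (rule nn_integral_cong)
    fix t
    have "(\<integral>\<^sup>+u. h (t * u + t * (1 - u)) * ennreal (gamma_density (a + b) t * beta_density a b u) \<partial>lborel)
       = (\<integral>\<^sup>+u. h t * ennreal (gamma_density (a + b) t) * ennreal (beta_density a b u) \<partial>lborel)"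
      using a b by (intro nn_integral_cong) (simp add: right_diff_distrib ennreal_mult gamma_density_nonneg beta_density_nonneg ac_simps)
    also have "\<dots> = h t * ennreal (gamma_density (a + b) t)"
      by (subst nn_integral_cmult) (auto simp: nn_integral_beta_density[OF a b])
    finally show "(\<integral>\<^sup>+u. h (t * u + t * (1 - u)) * ennreal (gamma_density (a + b) t * beta_density a b u) \<partial>lborel) = h t * ennreal (gamma_density (a + b) t)" .
  qed
  finally show ?thesis .
qed

section \<open>Squares of standard normal variables and their ratios\<close>

text \<open>Distribution functions are compared. For \<open>t \<ge> 0\<close> the event is an
  interval symmetric about 0, whose mass is twice that of its right half; substituting
  \<open>x\<^sup>2 / 2\<close> in the Gamma integral gives the same value because
  \<open>Gamma (1/2) = sqrt pi\<close>.\<close>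

lemma distr_half_square_std_normal:
  "distr std_normal borel (\<lambda>x. x\<^sup>2 / 2) = density lborel (\<lambda>t. ennreal (gamma_density (1 / 2) t))"
    (is "?M = ?N")
proof (rule cdf_unique)
  show "real_distribution ?M"
    by (intro real_distribution.intro std_normal.prob_space_distr) (auto simp: real_distribution_axioms_def)
  show "real_distribution ?N"
    by (intro real_distribution.intro prob_spaceI)
       (auto simp: real_distribution_axioms_def emeasure_density nn_integral_gamma_density)
  show "cdf ?M = cdf ?N"
  proof (rule ext)
    fix t :: real
    have "emeasure ?M {..t} = emeasure ?N {..t}"
    proof (cases "t \<ge> 0")
      case False
      then have "(\<lambda>x::real. x\<^sup>2 / 2) -` {..t} = {}"
        using zero_le_power2 by (smt (verit, best) Collect_empty_eq vimage_def atMost_iff divide_nonneg_nonneg)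
      moreover have "(\<lambda>x. ennreal (gamma_density (1/2) x) * indicator {..t} x) = (\<lambda>_. 0)"
        using False by (auto simp: gamma_density_def indicator_def fun_eq_iff)
      ultimately show ?thesis
        by (simp add: emeasure_distr emeasure_density)
    next
      case True
      define s where "s = sqrt (2 * t)"
      have s: "s \<ge> 0" "s\<^sup>2 / 2 = t" using True by (auto simp: s_def)
      have sq: "x\<^sup>2 / 2 \<le> t \<longleftrightarrow> - s \<le> x \<and> x \<le> s" for x
      proof -
        have "x\<^sup>2 / 2 \<le> t \<longleftrightarrow> x\<^sup>2 \<le> s\<^sup>2" using s(2) by auto
        also have "\<dots> \<longleftrightarrow> \<bar>x\<bar> \<le> s" using s(1) by (simp add: abs_le_square_iff[symmetric])
        finally show ?thesis by auto
      qed
      have vim: "(\<lambda>x::real. x\<^sup>2 / 2) -` {..t} = {-s..s}" using sq by auto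
      define I where "I = (\<integral>\<^sup>+x. ennreal (std_normal_density x * indicator {0..s} x) \<partial>lborel)"
      have "emeasure ?M {..t} = (\<integral>\<^sup>+x. ennreal (std_normal_density x) * indicator {-s..s} x \<partial>lborel)"
        by (subst emeasure_distr) (auto simp: emeasure_density vim)
      also have "\<dots> = (\<integral>\<^sup>+x. ennreal (std_normal_density x * indicator {0..s} x) + ennreal (std_normal_density x * indicator {-s..0} x) \<partial>lborel)"
      proof (rule nn_integral_cong_AE)
        have "AE t in lborel. t \<noteq> (0::real)" by (rule AE_lborel_singleton)
        then show "AE x in lborel. ennreal (std_normal_density x) * indicator {-s..s} x =
            ennreal (std_normal_density x * indicator {0..s} x) + ennreal (std_normal_density x * indicator {-s..0} x)"
          by eventually_elim (use s in \<open>auto simp: indicator_def\<close>)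
      qed
      also have "\<dots> = I + (\<integral>\<^sup>+x. ennreal (std_normal_density x * indicator {-s..0} x) \<partial>lborel)"
        unfolding I_def by (subst nn_integral_add) auto
      also have "(\<integral>\<^sup>+x. ennreal (std_normal_density x * indicator {-s..0} x) \<partial>lborel) = I"
        unfolding I_def
        by (subst nn_integral_real_affine[where c = "-1" and t = 0])
           (auto simp: std_normal_density_def indicator_def intro!: nn_integral_cong)
      also have "I + I = (\<integral>\<^sup>+x. ennreal (2 * std_normal_density x * indicator {0..s} x) \<partial>lborel)"
        unfolding I_def
        by (subst nn_integral_add[symmetric]) (auto simp: indicator_def ennreal_plus[symmetric] simp del: ennreal_plus intro!: nn_integral_cong)
      finally have M: "emeasure ?M {..t} = (\<integral>\<^sup>+x. ennreal (2 * std_normal_density x * indicator {0..s} x) \<partial>lborel)" .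
      \<comment> \<open>The limits are written as values of \<open>x\<^sup>2/2\<close> at
        \<open>0\<close> and \<open>s\<close> to fit the substitution rule.\<close>
      have "emeasure ?N {..t} = (\<integral>\<^sup>+x. ennreal (gamma_density (1/2) x * indicator {0\<^sup>2/2..s\<^sup>2/2} x) \<partial>lborel)"
        by (subst emeasure_density) (auto simp: s indicator_def gamma_density_def intro!: nn_integral_cong)
      also have "\<dots> = (\<integral>\<^sup>+x. ennreal (gamma_density (1/2) (x\<^sup>2/2) * x * indicator {0..s} x) \<partial>lborel)"
      proof (rule nn_integral_substitution[where g = "\<lambda>x. x\<^sup>2/2" and g' = "\<lambda>x. x"])
        show "((\<lambda>x. x\<^sup>2/2) has_real_derivative x) (at x)" for x :: real
          by (auto intro!: derivative_eq_intros)
      qed (use s(1) in \<open>auto simp: set_borel_measurable_def\<close>)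
      also have "\<dots> = (\<integral>\<^sup>+x. ennreal (2 * std_normal_density x * indicator {0..s} x) \<partial>lborel)"
      proof (rule nn_integral_cong_AE)
        have *: "gamma_density (1/2) (x\<^sup>2/2) * x = 2 * std_normal_density x" if "x > 0" for x
        proof -
          have "(x\<^sup>2/2) powr (1/2 - 1) = inverse (sqrt (x\<^sup>2/2))"
            using that by (simp add: powr_half_sqrt powr_minus)
          also have "\<dots> = sqrt 2 / x"
            using that by (simp add: real_sqrt_divide)
          finally have "gamma_density (1/2) (x\<^sup>2/2) * x = sqrt 2 / x * exp (- (x\<^sup>2/2)) / sqrt pi * x"
            using that unfolding gamma_density_def by (simp add: Gamma_one_half_real)
          also have "\<dots> = 2 * std_normal_density x"
            using that by (simp add: std_normal_density_def real_sqrt_mult field_simps)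
          finally show ?thesis .
        qed
        \<comment> \<open>At \<open>x = 0\<close> the identity fails: the left side is 0 while the
          normal density is positive.\<close>
        have "AE t in lborel. t \<noteq> (0::real)" by (rule AE_lborel_singleton)
        then show "AE x in lborel. ennreal (gamma_density (1/2) (x\<^sup>2/2) * x * indicator {0..s} x) =
            ennreal (2 * std_normal_density x * indicator {0..s} x)"
          by eventually_elim (auto simp: indicator_def *)
      qed
      finally show ?thesis using M by simp
    qed
    then show "cdf ?M t = cdf ?N t"
      by (simp add: cdf_def measure_def)
  qed
qed

lemma nn_integral_std_normal_half_square:
  assumes [measurable]: "h \<in> borel_measurable borel"
  shows "(\<integral>\<^sup>+y. h (y\<^sup>2 / 2) \<partial>std_normal) = (\<integral>\<^sup>+t. h t * ennreal (gamma_density (1/2) t) \<partial>lborel)"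
proof -
  have "(\<integral>\<^sup>+y. h (y\<^sup>2 / 2) \<partial>std_normal) = (\<integral>\<^sup>+t. h t \<partial>(distr std_normal borel (\<lambda>x. x\<^sup>2 / 2)))"
    by (subst nn_integral_distr) auto
  also have "\<dots> = (\<integral>\<^sup>+t. h t * ennreal (gamma_density (1/2) t) \<partial>lborel)"
    unfolding distr_half_square_std_normal
    by (subst nn_integral_density) (auto simp: mult.commute)
  finally show ?thesis .
qed

text \<open>Each further square adds 1/2 to the shape parameter. The function \<open>h\<close> must
  vary in the induction, because integrating out the new coordinate changes it.\<close>

lemma nn_integral_std_normal_sum_squares:
  assumes "finite I" "I \<noteq> {}" and "h \<in> borel_measurable borel"
  shows "(\<integral>\<^sup>+x. h (\<Sum>i\<in>I. (x i)\<^sup>2 / 2) \<partial>(PiM I (\<lambda>_. std_normal)))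
      = (\<integral>\<^sup>+t. h t * ennreal (gamma_density (card I / 2) t) \<partial>lborel)"
  using assms
proof (induction I arbitrary: h rule: finite_ne_induct)
  case (singleton i)
  note [measurable] = singleton
  show ?case
    using std_normal_PiM.product_nn_integral_singleton[of "\<lambda>y. h (y\<^sup>2 / 2)" i]
    by (simp add: nn_integral_std_normal_half_square)
next
  case (insert i I)
  note [measurable] = insert.prems
  have card: "real (card (insert i I)) / 2 = card I / 2 + 1 / 2"
    using insert.hyps by (simp add: add_divide_distrib)
  have pos: "real (card I) / 2 > 0" using insert.hyps by (simp add: card_gt_0_iff)
  have "(\<integral>\<^sup>+x. h (\<Sum>i\<in>insert i I. (x i)\<^sup>2 / 2) \<partial>(PiM (insert i I) (\<lambda>_. std_normal)))
     = (\<integral>\<^sup>+x. \<integral>\<^sup>+y. h ((\<Sum>j\<in>I. (x j)\<^sup>2 / 2) + y\<^sup>2 / 2) \<partial>std_normal \<partial>(PiM I (\<lambda>_. std_normal)))"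
    using insert.hyps
    by (subst std_normal_PiM.product_nn_integral_insert)
       (auto intro!: nn_integral_cong arg_cong[where f = h] sum.cong simp: add.commute)
  also have "\<dots> = (\<integral>\<^sup>+x. (\<integral>\<^sup>+y. h ((\<Sum>j\<in>I. (x j)\<^sup>2 / 2) + y) * ennreal (gamma_density (1/2) y) \<partial>lborel) \<partial>(PiM I (\<lambda>_. std_normal)))"
    by (intro nn_integral_cong nn_integral_std_normal_half_square) auto
  also have "\<dots> = (\<integral>\<^sup>+t. (\<integral>\<^sup>+y. h (t + y) * ennreal (gamma_density (1/2) y) \<partial>lborel) * ennreal (gamma_density (card I / 2) t) \<partial>lborel)"
    by (rule insert.IH) measurable
  also have "\<dots> = (\<integral>\<^sup>+t. h t * ennreal (gamma_density (card I / 2 + 1 / 2) t) \<partial>lborel)"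
    using pos by (intro nn_integral_gamma_sum) auto
  finally show ?case unfolding card .
qed

text \<open>The sums over \<open>I\<close> and \<open>J\<close> are independent Gamma variables up
  to a factor 2. In the coordinates total \<open>t\<close> and fraction \<open>u\<close> the event
  constrains \<open>u\<close> only, and \<open>t\<close> integrates out.\<close>

lemma emeasure_std_normal_ratio:
  assumes I: "finite I" "I \<noteq> {}" and J: "finite J" "J \<noteq> {}" and IJ: "I \<inter> J = {}"
  shows "emeasure (PiM (I \<union> J) (\<lambda>_. std_normal))
      {x \<in> space (PiM (I \<union> J) (\<lambda>_. std_normal)). (\<Sum>i\<in>I. (x i)\<^sup>2) \<le> s * (\<Sum>i\<in>I \<union> J. (x i)\<^sup>2)}
     = (\<integral>\<^sup>+u. ennreal (beta_density (card I / 2) (card J / 2) u) * indicator {..s} u \<partial>lborel)"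
proof -
  define a b where "a = real (card I) / 2" and "b = real (card J) / 2"
  have a: "a > 0" and b: "b > 0" using I J by (auto simp: a_def b_def card_gt_0_iff)
  \<comment> \<open>The inequality is homogeneous in the squares, so it may be stated for their
    halves.\<close>
  define h :: "real \<Rightarrow> real \<Rightarrow> ennreal" where "h x y = indicator {..0} (x - s * (x + y))" for x y
  have [measurable]: "(\<lambda>(x, y). h x y) \<in> borel_measurable (borel \<Otimes>\<^sub>M borel)"
    unfolding h_def by measurable
  let ?P = "\<lambda>I. PiM I (\<lambda>_. std_normal)"
  let ?S = "\<lambda>I x. \<Sum>i\<in>I. (x i)\<^sup>2 / 2"
  have "emeasure (?P (I \<union> J)) {x \<in> space (?P (I \<union> J)). (\<Sum>i\<in>I. (x i)\<^sup>2) \<le> s * (\<Sum>i\<in>I \<union> J. (x i)\<^sup>2)}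
     = (\<integral>\<^sup>+x. h (?S I x) (?S J x) \<partial>(?P (I \<union> J)))"
  proof -
    have eq: "h (?S I x) (?S J x) = indicator {x \<in> space (?P (I \<union> J)). (\<Sum>i\<in>I. (x i)\<^sup>2) \<le> s * (\<Sum>i\<in>I \<union> J. (x i)\<^sup>2)} x"
      if "x \<in> space (?P (I \<union> J))" for x
      using that I J IJ
      by (simp add: h_def indicator_def sum.union_disjoint sum_divide_distrib[symmetric] field_simps)
    show ?thesis
      by (subst nn_integral_cong[OF eq]) simp_all
  qed
  also have "\<dots> = (\<integral>\<^sup>+x. \<integral>\<^sup>+y. h (?S I x) (?S J y) \<partial>(?P J) \<partial>(?P I))"
  proof -
    have [simp]: "?S I (merge I J (x, y)) = ?S I x" "?S J (merge I J (x, y)) = ?S J y" for x y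
      using IJ by (auto intro!: sum.cong simp: merge_def)
    show ?thesis
      using I J IJ by (subst std_normal_PiM.product_nn_integral_fold) simp_all
  qed
  also have "\<dots> = (\<integral>\<^sup>+x. (\<integral>\<^sup>+y. h (?S I x) y * ennreal (gamma_density b y) \<partial>lborel) \<partial>(?P I))"
    unfolding b_def using J
    by (intro nn_integral_cong nn_integral_std_normal_sum_squares) auto
  also have "\<dots> = (\<integral>\<^sup>+x. (\<integral>\<^sup>+y. h x y * ennreal (gamma_density b y) \<partial>lborel) * ennreal (gamma_density a x) \<partial>lborel)"
    unfolding a_def using I
    by (intro nn_integral_std_normal_sum_squares) auto
  also have "\<dots> = (\<integral>\<^sup>+x. \<integral>\<^sup>+y. h x y * ennreal (gamma_density a x * gamma_density b y) \<partial>lborel \<partial>lborel)"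
    by (intro nn_integral_cong, subst nn_integral_multc[symmetric])
       (auto simp: ennreal_mult' gamma_density_nonneg[OF a] ac_simps)
  also have "\<dots> = (\<integral>\<^sup>+t. \<integral>\<^sup>+u. h (t * u) (t * (1 - u)) * ennreal (gamma_density (a + b) t * beta_density a b u) \<partial>lborel \<partial>lborel)"
    by (rule nn_integral_gamma_gamma[OF a b]) measurable
  also have "\<dots> = (\<integral>\<^sup>+t. ennreal (gamma_density (a + b) t) * (\<integral>\<^sup>+u. ennreal (beta_density a b u) * indicator {..s} u \<partial>lborel) \<partial>lborel)"
  proof (rule nn_integral_cong)
    fix t
    have "(\<integral>\<^sup>+u. h (t * u) (t * (1 - u)) * ennreal (gamma_density (a + b) t * beta_density a b u) \<partial>lborel)
       = (\<integral>\<^sup>+u. ennreal (gamma_density (a + b) t) * (ennreal (beta_density a b u) * indicator {..s} u) \<partial>lborel)"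
    proof (cases "t > 0")
      case True
      have "h (t * u) (t * (1 - u)) = indicator {..s} u" for u
      proof -
        have "t * u - s * (t * u + t * (1 - u)) = t * (u - s)" by (simp add: algebra_simps)
        then show ?thesis using True by (simp add: h_def indicator_def mult_le_0_iff)
      qed
      then show ?thesis
        using a b by (intro nn_integral_cong) (simp add: ennreal_mult beta_density_nonneg gamma_density_nonneg ac_simps)
    qed (simp add: gamma_density_def)
    also have "\<dots> = ennreal (gamma_density (a + b) t) * (\<integral>\<^sup>+u. ennreal (beta_density a b u) * indicator {..s} u \<partial>lborel)"
      by (subst nn_integral_cmult) auto
    finally show "(\<integral>\<^sup>+u. h (t * u) (t * (1 - u)) * ennreal (gamma_density (a + b) t * beta_density a b u) \<partial>lborel) = ennreal (gamma_density (a + b) t) * (\<integral>\<^sup>+u. ennreal (beta_density a b u) * indicator {..s} u \<partial>lborel)" .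
  qed
  also have "\<dots> = (\<integral>\<^sup>+u. ennreal (beta_density a b u) * indicator {..s} u \<partial>lborel)"
    using a b by (subst nn_integral_multc) (auto simp: nn_integral_gamma_density)
  finally show ?thesis by (simp add: a_def b_def)
qed

section \<open>The Beta distribution function\<close>

text \<open>Since \<open>b \<ge> 1\<close>, the factor \<open>(1 - u) powr (b - 1)\<close> is at
  least its value at \<open>s\<close> on the whole range; the remaining power of \<open>u\<close>
  integrates to \<open>s powr a / a\<close>.\<close>

lemma nn_integral_beta_density_lower_bound:
  fixes a b s :: real
  assumes "a > 0" "b \<ge> 1" "0 < s" "s < 1"
  shows "ennreal (s powr a * (1 - s) powr (b - 1) / (a * Beta a b))
    \<le> (\<integral>\<^sup>+u. ennreal (beta_density a b u) * indicator {..s} u \<partial>lborel)"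
proof -
  have B: "Beta a b > 0" using assms by (intro Beta_real_pos) auto
  define K where "K = (1 - s) powr (b - 1) / Beta a b"
  have K: "K \<ge> 0" using B by (simp add: K_def)
  have "((\<lambda>u. u powr (a - 1)) has_integral (s powr a / a)) {0..s}"
    using has_integral_powr_from_0[of "a - 1" s] assms by simp
  then have "((\<lambda>u. K * u powr (a - 1)) has_integral (K * (s powr a / a))) {0..s}"
    by (rule has_integral_mult_right)
  from nn_integral_has_integral_lebesgue[OF _ this] K
  have "ennreal (K * (s powr a / a)) = (\<integral>\<^sup>+u. ennreal (indicator {0..s} u * (K * u powr (a - 1))) \<partial>lborel)"
    by simp
  also have "\<dots> \<le> (\<integral>\<^sup>+u. ennreal (beta_density a b u) * indicator {..s} u \<partial>lborel)"
  proof (rule nn_integral_mono)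
    fix u :: real
    show "ennreal (indicator {0..s} u * (K * u powr (a - 1))) \<le> ennreal (beta_density a b u) * indicator {..s} u"
    proof (cases "0 < u \<and> u \<le> s")
      case True
      have "(1 - s) powr (b - 1) \<le> (1 - u) powr (b - 1)"
        using True assms by (intro powr_mono2) auto
      then have "u powr (a - 1) * (1 - s) powr (b - 1) / Beta a b \<le> u powr (a - 1) * (1 - u) powr (b - 1) / Beta a b"
        using B by (intro divide_right_mono mult_left_mono) auto
      then show ?thesis
        using True assms by (simp add: K_def beta_density_def ennreal_leI mult.commute)
    next
      case False
      \<comment> \<open>At \<open>u = 0\<close> the left side is 0 even when \<open>a < 1\<close>,
        because \<open>0 powr x = 0\<close>.\<close>
      then have "u = 0 \<or> u \<notin> {0..s}" by auto
      then show ?thesis by (auto simp: indicator_def)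
    qed
  qed
  also have "K * (s powr a / a) = s powr a * (1 - s) powr (b - 1) / (a * Beta a b)"
    by (simp add: K_def mult_ac)
  finally show ?thesis .
qed

text \<open>For second parameter 1/2 the monotonicity argument fails, but the substitution
  \<open>u = (sin x)\<^sup>2\<close> gives an exact value: the \<open>cos x\<close> of the
  derivative cancels \<open>(1 - u) powr (- 1 / 2)\<close>.\<close>

lemma nn_integral_beta_half_arcsin:
  fixes r :: real and N :: nat
  assumes r: "0 < r" "r < 1" and N: "N \<ge> 2"
  shows "(\<integral>\<^sup>+u. ennreal (beta_density (real (N - 1) / 2) (1 / 2) u) * indicator {..r\<^sup>2} u \<partial>lborel)
     = ennreal (2 / Beta (real (N - 1) / 2) (1 / 2) * integral {0..arcsin r} (\<lambda>x. sin x ^ (N - 2)))"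
proof -
  let ?a = "real (N - 1) / 2"
  define \<theta> where "\<theta> = arcsin r"
  have B: "Beta ?a (1 / 2) > 0" using N by (intro Beta_real_pos) auto
  have \<theta>: "0 < \<theta>" "\<theta> < pi / 2" "sin \<theta> = r"
    using r arcsin_less_arcsin[of 0 r] arcsin_less_arcsin[of r 1] by (auto simp: \<theta>_def)
  have pos: "sin x > 0" "cos x > 0" if "0 < x" "x \<le> \<theta>" for x
    using that \<theta> by (auto intro!: sin_gt_zero cos_gt_zero)
  have nonneg: "sin x \<ge> 0" "cos x \<ge> 0" if "0 \<le> x" "x \<le> \<theta>" for x
    using that \<theta> by (auto intro!: sin_ge_zero cos_ge_zero)
  have "(\<integral>\<^sup>+u. ennreal (beta_density ?a (1 / 2) u) * indicator {..r\<^sup>2} u \<partial>lborel)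
     = (\<integral>\<^sup>+u. ennreal (beta_density ?a (1 / 2) u * indicator {(sin 0)\<^sup>2..(sin \<theta>)\<^sup>2} u) \<partial>lborel)"
    by (intro nn_integral_cong) (auto simp: indicator_def beta_density_def \<theta>(3))
  also have "\<dots> = (\<integral>\<^sup>+x. ennreal (beta_density ?a (1 / 2) ((sin x)\<^sup>2) * (2 * sin x * cos x) * indicator {0..\<theta>} x) \<partial>lborel)"
  proof (rule nn_integral_substitution[where g = "\<lambda>x. (sin x)\<^sup>2" and g' = "\<lambda>x. 2 * sin x * cos x"])
    show "((\<lambda>x. (sin x)\<^sup>2) has_real_derivative 2 * sin x * cos x) (at x)" for x :: real
      by (auto intro!: derivative_eq_intros)
    show "continuous_on {0..\<theta>} (\<lambda>x. 2 * sin x * cos x)" by (intro continuous_intros)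
    show "0 \<le> 2 * sin x * cos x" if "x \<in> {0..\<theta>}" for x using nonneg that by simp
  qed (use \<theta> in \<open>auto simp: set_borel_measurable_def\<close>)
  also have "\<dots> = (\<integral>\<^sup>+x. ennreal (indicator {0..\<theta>} x * (2 / Beta ?a (1 / 2) * sin x ^ (N - 2))) \<partial>lborel)"
  proof (rule nn_integral_cong_AE)
    have *: "beta_density ?a (1 / 2) ((sin x)\<^sup>2) * (2 * sin x * cos x) = 2 / Beta ?a (1 / 2) * sin x ^ (N - 2)"
      if x: "0 < x" "x \<le> \<theta>" for x
    proof -
      note p = pos[OF x]
      have c2: "1 - (sin x)\<^sup>2 = (cos x)\<^sup>2" by (simp add: cos_squared_eq)
      have lt: "(sin x)\<^sup>2 < 1" using c2 zero_less_power[OF p(2), of 2] by linarith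
      have sq: "(sin x)\<^sup>2 = sin x powr 2" "(cos x)\<^sup>2 = cos x powr 2"
        using p by simp_all
      have e1: "((sin x)\<^sup>2) powr (?a - 1) = sin x powr (real (N - 1) - 2)"
        unfolding sq(1) powr_powr by (simp add: algebra_simps)
      have e2: "((cos x)\<^sup>2) powr (1 / 2 - 1) = 1 / cos x"
        unfolding sq(2) powr_powr using p by (simp add: powr_minus_divide)
      \<comment> \<open>For \<open>N = 2\<close> the exponent on the left is -1, so the extra factor
        \<open>sin x\<close> is absorbed before passing to a natural power.\<close>
      have e3: "sin x powr (real (N - 1) - 2) * sin x = sin x ^ (N - 2)"
      proof -
        have "sin x powr (real (N - 1) - 2) * sin x powr 1 = sin x powr (real (N - 2))"
          unfolding powr_add[symmetric] using N by (simp add: of_nat_diff)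
        then show ?thesis using p by (simp add: powr_realpow)
      qed
      have "beta_density ?a (1 / 2) ((sin x)\<^sup>2) * (2 * sin x * cos x)
         = ((sin x)\<^sup>2) powr (?a - 1) * ((cos x)\<^sup>2) powr (1 / 2 - 1) / Beta ?a (1 / 2) * (2 * sin x * cos x)"
        using p lt by (simp add: beta_density_def c2)
      also have "\<dots> = 2 / Beta ?a (1 / 2) * (sin x powr (real (N - 1) - 2) * sin x)"
        unfolding e1 e2 using p by simp
      finally show ?thesis unfolding e3 .
    qed
    \<comment> \<open>The point 0 is left out because for \<open>N = 2\<close> the right side
      contains \<open>sin 0 ^ 0 = 1\<close>, whereas the left side is 0.\<close>
    have "AE x in lborel. x \<noteq> (0::real)" by (rule AE_lborel_singleton)
    then show "AE x in lborel. ennreal (beta_density ?a (1 / 2) ((sin x)\<^sup>2) * (2 * sin x * cos x) * indicator {0..\<theta>} x)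
        = ennreal (indicator {0..\<theta>} x * (2 / Beta ?a (1 / 2) * sin x ^ (N - 2)))"
    proof eventually_elim
      case (elim x)
      show ?case
      proof (cases "x \<in> {0..\<theta>}")
        case True
        then have "0 < x" "x \<le> \<theta>" using elim by auto
        from *[OF this] show ?thesis by (simp only: mult.commute)
      qed simp
    qed
  qed
  also have "\<dots> = ennreal (2 / Beta ?a (1 / 2) * integral {0..\<theta>} (\<lambda>x. sin x ^ (N - 2)))"
  proof (rule nn_integral_has_integral_lebesgue)
    show "0 \<le> 2 / Beta ?a (1 / 2) * sin x ^ (N - 2)" if "x \<in> {0..\<theta>}" for x
      using B nonneg that by simp
    show "((\<lambda>x. 2 / Beta ?a (1 / 2) * sin x ^ (N - 2)) has_integral 2 / Beta ?a (1 / 2) * integral {0..\<theta>} (\<lambda>x. sin x ^ (N - 2))) {0..\<theta>}"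
      by (intro has_integral_mult_right integrable_integral integrable_continuous_interval continuous_intros)
  qed
  finally show ?thesis by (simp add: \<theta>_def)
qed

section \<open>Gaussian matrices\<close>

text \<open>Projections of Borel sets need not be Borel. A closed set, however, is a countable union
  of compact sets, and these have compact images.\<close>

lemma borel_fst_image_closed:
  fixes C :: "('a::euclidean_space \<times> 'b::euclidean_space) set"
  assumes "closed C"
  shows "fst ` C \<in> sets borel"
proof -
  obtain F where F: "\<And>n. compact (F n)" "(\<Union>n::nat. F n) = C"
    using closed_Union_compact_subsets[OF assms] by metis
  have "compact (fst ` F n)" for n
    by (intro compact_continuous_image F continuous_intros)
  then have "(\<Union>n. fst ` F n) \<in> sets borel"
    by (intro sets.countable_UN) (auto intro: borel_closed compact_imp_closed)
  then show ?thesis using F(2) by (simp flip: image_UN)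
qed

lemma borel_Ex_closed:
  fixes P :: "'a::euclidean_space \<Rightarrow> 'b::euclidean_space \<Rightarrow> bool"
  assumes "closed {p. P (fst p) (snd p)}"
  shows "{x. \<exists>y. P x y} \<in> sets borel"
proof -
  have "{x. \<exists>y. P x y} = fst ` {p. P (fst p) (snd p)}" by (auto simp: image_iff)
  then show ?thesis using borel_fst_image_closed[OF assms] by simp
qed

lemma continuous_on_matrix_vector_mult [continuous_intros]:
  fixes f :: "'a::topological_space \<Rightarrow> real^'d^'n" and g :: "'a \<Rightarrow> real^'d"
  assumes "continuous_on S f" "continuous_on S g"
  shows "continuous_on S (\<lambda>x. f x *v g x)"
  unfolding matrix_vector_mult_def by (intro continuous_intros assms)

section \<open>Almost sure injectivity of a Gaussian matrix\<close>

lemma emeasure_std_gaussian_negligible: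
  assumes "negligible S" "S \<in> sets borel"
  shows "emeasure std_gaussian S = 0"
proof -
  have "S \<in> null_sets lborel"
    using assms by (simp add: negligible_iff_null_sets null_sets_completion_iff)
  then show ?thesis
    using assms unfolding std_gaussian_def
    by (subst emeasure_density) (auto simp: nn_integral_0_iff_AE AE_density dest!: AE_not_in elim!: eventually_mono)
qed

text \<open>Used to recognise maps of matrices as orthogonal: it suffices that they preserve inner
  products column by column, or permute columns.\<close>

lemma inner_matrix_columns:
  fixes B C :: "real^'d^'n"
  shows "B \<bullet> C = (\<Sum>k\<in>UNIV. column k B \<bullet> column k C)"
  unfolding inner_vec_def column_def by (simp add: inner_vec_def) (rule sum.swap)

lemma matrix_vector_mult_sum_columns:
  fixes B :: "real^'d^'n"
  shows "B *v y = (\<Sum>k\<in>UNIV. y $ k *\<^sub>R column k B)"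
  by (simp add: matrix_mult_sum scalar_mult_eq_scaleR)

lemma column_matrix_matrix_mult:
  fixes B :: "real^'d^'n" and Q :: "real^'n^'m"
  shows "column k (Q ** B) = Q *v column k B"
  by (simp add: vec_eq_iff column_def matrix_matrix_mult_def matrix_vector_mult_def)

text \<open>Exchanging a column of a Gaussian matrix with an independent Gaussian vector preserves the
  joint law, and the vector almost surely avoids the span of the other columns.\<close>

lemma AE_std_gaussian_inj:
  assumes dn: "CARD('d) \<le> CARD('n)"
  shows "AE B in (std_gaussian :: (real^'d^'n) measure). inj ((*v) B)"
proof -
  \<comment> \<open>A nonzero kernel vector can be scaled to have some entry equal to 1. Unlike
    \<open>y \<noteq> 0\<close>, this normalisation is a closed condition, so \<open>bad j\<close>
    is Borel.\<close>
  define bad :: "'d \<Rightarrow> (real^'d^'n) set" where "bad j = {B. \<exists>y. y $ j = 1 \<and> B *v y = 0}" for j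
  have bad_sets [measurable]: "bad j \<in> sets borel" for j
    unfolding bad_def
    by (intro borel_Ex_closed closed_Collect_conj closed_Collect_eq continuous_intros)
  have null: "emeasure std_gaussian (bad j) = 0" for j
  proof -
    define sw :: "real^'d^'n \<Rightarrow> real^'n \<Rightarrow> real^'d^'n"
      where "sw B z = (\<chi> i k. if k = j then z $ i else B $ i $ k)" for B z
    define F :: "(real^'d^'n) \<times> (real^'n) \<Rightarrow> (real^'d^'n) \<times> (real^'n)"
      where "F = (\<lambda>p. (sw (fst p) (snd p), column j (fst p)))"
    have col: "column k (sw B z) = (if k = j then z else column k B)" for k B z
      by (simp add: column_def sw_def vec_eq_iff)
    have "linear F"
      by (intro linearI) (auto simp: F_def sw_def column_def vec_eq_iff)
    moreover have "F p \<bullet> F q = p \<bullet> q" for p q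
      by (cases p; cases q)
        (simp add: F_def inner_matrix_columns col sum.remove[of UNIV j])
    ultimately have F: "orthogonal_transformation F"
      by (simp add: orthogonal_transformation_def)
    note [measurable] = orthogonal_transformation_borel_measurable[OF F]
    have "emeasure std_gaussian (bad j)
        = emeasure (distr (distr (std_gaussian :: ((real^'d^'n) \<times> (real^'n)) measure) borel F) borel fst) (bad j)"
      by (simp add: distr_std_gaussian_orthogonal[OF F] distr_std_gaussian_fst)
    also have "\<dots> = emeasure (std_gaussian :: ((real^'d^'n) \<times> (real^'n)) measure) ((fst \<circ> F) -` bad j)"
      by (subst distr_distr) (auto simp: emeasure_distr)
    also have "\<dots> = emeasure ((std_gaussian :: (real^'d^'n) measure) \<Otimes>\<^sub>M (std_gaussian :: (real^'n) measure)) ((fst \<circ> F) -` bad j)"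
      by (simp only: std_gaussian_prod)
    also have "\<dots> = (\<integral>\<^sup>+B. emeasure (std_gaussian :: (real^'n) measure) (Pair B -` ((fst \<circ> F) -` bad j)) \<partial>(std_gaussian :: (real^'d^'n) measure))"
    proof (rule std_gaussian.emeasure_pair_measure_alt)
      have "(fst \<circ> F) -` bad j \<in> sets borel"
        by (rule measurable_sets_borel[of "fst \<circ> F" borel]) measurable
      then show "(fst \<circ> F) -` bad j \<in> sets ((std_gaussian :: (real^'d^'n) measure) \<Otimes>\<^sub>M (std_gaussian :: (real^'n) measure))"
        by (simp only: std_gaussian_prod sets_std_gaussian)
    qed
    also have "\<dots> = (\<integral>\<^sup>+B. 0 \<partial>(std_gaussian :: (real^'d^'n) measure))"
    proof (rule nn_integral_cong)
      fix B :: "real^'d^'n"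
      \<comment> \<open>For fixed \<open>B\<close> only the new column \<open>z\<close> is random.
        The other columns number at most \<open>CARD('d) - 1 < CARD('n)\<close>, so their span is a
        null set.\<close>
      let ?W = "span ((\<lambda>k. column k B) ` (UNIV - {j}))"
      have "dim ?W \<le> card ((\<lambda>k. column k B) ` (UNIV - {j}))"
        unfolding dim_span by (rule dim_le_card') simp
      also have "\<dots> \<le> card (UNIV - {j} :: 'd set)" by (rule card_image_le) simp
      also have "\<dots> = CARD('d) - 1" by (simp add: card_Diff_singleton)
      also have "\<dots> < CARD('n)" using dn zero_less_card_finite[where 'a = 'd] by linarith
      also have "\<dots> = DIM(real^'n)" by simp
      finally have "negligible ?W" by (rule negligible_lowdim)
      then have "emeasure std_gaussian ?W = 0"
        by (rule emeasure_std_gaussian_negligible) (simp add: closed_span)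
      moreover have "Pair B -` ((fst \<circ> F) -` bad j) \<subseteq> ?W"
      proof
        fix z assume "z \<in> Pair B -` ((fst \<circ> F) -` bad j)"
        then obtain y where y: "y $ j = 1" "sw B z *v y = 0" by (auto simp: F_def bad_def)
        \<comment> \<open>As \<open>y $ j = 1\<close>, the kernel relation can be solved for column
          \<open>j\<close>, which is \<open>z\<close>.\<close>
        have "0 = z + (\<Sum>k\<in>UNIV - {j}. y $ k *\<^sub>R column k B)"
          using y by (simp add: matrix_vector_mult_sum_columns sum.remove[of UNIV j] col)
        then have "z = - (\<Sum>k\<in>UNIV - {j}. y $ k *\<^sub>R column k B)"
          by (simp add: eq_neg_iff_add_eq_0)
        then show "z \<in> ?W"
          by (simp only:) (intro span_neg span_sum span_scale span_base imageI)
      qed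
      ultimately show "emeasure std_gaussian (Pair B -` ((fst \<circ> F) -` bad j)) = 0"
        using emeasure_mono[of "Pair B -` ((fst \<circ> F) -` bad j)" ?W std_gaussian]
        by (simp add: closed_span)
    qed
    finally show ?thesis by simp
  qed
  have "AE B in (std_gaussian :: (real^'d^'n) measure). \<forall>j. B \<notin> bad j"
    by (intro AE_all_countable[THEN iffD2] allI AE_not_in null_setsI null) auto
  then show ?thesis
  proof eventually_elim
    case (elim B)
    show ?case
      unfolding matrix_left_invertible_injective[symmetric] matrix_left_invertible_ker
    proof (intro allI impI)
      fix y assume y: "B *v y = 0"
      show "y = 0"
      proof (rule ccontr)
        assume "y \<noteq> 0"
        then obtain j where j: "y $ j \<noteq> 0" by (auto simp: vec_eq_iff)
        have "B *v ((1 / y $ j) *\<^sub>R y) = 0"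
          using y by (simp add: matrix_vector_mult_scaleR)
        with j have "B \<in> bad j" unfolding bad_def by (intro CollectI exI[of _ "(1 / y $ j) *\<^sub>R y"]) simp
        with elim show False by blast
      qed
    qed
  qed
qed

section \<open>Distance from a Gaussian vector to a fixed subspace\<close>

text \<open>Equal dimensions give an isometry of \<open>span S\<close> onto \<open>V\<close> and
  another between the orthogonal complements; their sum along the coordinate projections
  \<open>P S\<close> and \<open>P T\<close> preserves norms by Pythagoras.\<close>

lemma orthogonal_transformation_span_Basis:
  fixes V S :: "'a::euclidean_space set"
  assumes V: "subspace V" and S: "S \<subseteq> Basis" and card: "card S = dim V"
  obtains f where "orthogonal_transformation f" "f ` span S = V"
proof -
  define T where "T = Basis - S"
  define V' where "V' = {y. \<forall>x\<in>V. orthogonal x y}"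
  have T: "T \<subseteq> Basis" by (auto simp: T_def)
  have fin: "finite S" "finite T" using S T finite_subset finite_Basis by blast+
  have V': "subspace V'" unfolding V'_def by (rule subspace_orthogonal_to_vectors)
  have dS: "dim (span S) = dim V"
    using S by (simp add: card independent_substdbasis dim_eq_card_independent independent_Basis independent_mono[OF independent_Basis S])
  have "dim {y \<in> UNIV. \<forall>x\<in>V. orthogonal x y} + dim V = dim (UNIV :: 'a set)"
    by (rule dim_subspace_orthogonal_to_vectors) (use V in auto)
  then have "dim V' = DIM('a) - card S" using card by (simp add: V'_def)
  also have "\<dots> = card T" unfolding T_def using S fin by (simp add: card_Diff_subset)
  also have "\<dots> = dim (span T)"
    by (simp add: dim_eq_card_independent independent_mono[OF independent_Basis T])
  finally have dT: "dim (span T) = dim V'" by simp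
  obtain f where f: "linear f" "f ` span S = V" "\<And>x. x \<in> span S \<Longrightarrow> norm (f x) = norm x"
    using isometries_subspaces[OF subspace_span V dS] by metis
  obtain g where g: "linear g" "g ` span T = V'" "\<And>x. x \<in> span T \<Longrightarrow> norm (g x) = norm x"
    using isometries_subspaces[OF subspace_span V' dT] by metis
  define P where "P R x = (\<Sum>b\<in>R. (x \<bullet> b) *\<^sub>R b)" for R and x :: 'a
  have P: "linear (P R)" for R
    unfolding P_def by (intro linearI) (auto simp: inner_add_left scaleR_add_left sum.distrib scaleR_sum_right)
  have P_span: "P R x \<in> span R" for R x
    unfolding P_def by (intro span_sum span_scale span_base)
  have P_add: "x = P S x + P T x" for x
  proof -
    have "x = (\<Sum>b\<in>Basis. (x \<bullet> b) *\<^sub>R b)" by (simp add: euclidean_representation)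
    also have "\<dots> = P S x + P T x"
      unfolding P_def T_def using S by (subst sum.subset_diff[OF S]) (auto simp: add.commute)
    finally show ?thesis .
  qed
  have perp: "P S x \<bullet> P T y = 0" for x y
    unfolding P_def inner_sum_left inner_sum_right
    using S T by (auto intro!: sum.neutral simp: inner_Basis T_def subset_iff)
  define h where "h x = f (P S x) + g (P T x)" for x
  have lin: "linear h" unfolding h_def
    by (intro linear_compose_add linear_compose[OF P f(1), unfolded o_def] linear_compose[OF P g(1), unfolded o_def])
  have "norm (h x) = norm x" for x
  proof -
    have "f (P S x) \<in> V" "g (P T x) \<in> V'" using P_span f(2) g(2) by blast+
    then have "orthogonal (f (P S x)) (g (P T x))" by (auto simp: V'_def)
    then have "(norm (h x))\<^sup>2 = (norm (P S x))\<^sup>2 + (norm (P T x))\<^sup>2"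
      unfolding h_def by (subst norm_add_Pythagorean) (auto simp: f(3) g(3) P_span)
    also have "\<dots> = (norm (P S x + P T x))\<^sup>2"
      by (subst norm_add_Pythagorean) (auto simp: orthogonal_def perp)
    finally show ?thesis using P_add[of x] by simp
  qed
  with lin have orth: "orthogonal_transformation h"
    by (auto simp: orthogonal_transformation)
  have "h x = f x" if "x \<in> span S" for x
  proof -
    have "x \<bullet> b = 0" if "b \<in> T" for b
      using \<open>x \<in> span S\<close> that unfolding span_substd_basis[OF S] T_def by auto
    then have "P T x = 0" by (simp add: P_def)
    moreover from this have "P S x = x" using P_add[of x] by simp
    ultimately show ?thesis by (simp add: h_def linear_0[OF g(1)])
  qed
  then have "h ` span S = V" using f(2) by (metis image_cong)
  with orth show ?thesis using that by blast
qed

text \<open>After a rotation \<open>V\<close> is the coordinate subspace \<open>span S\<close>, and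
  the squared distance of \<open>g\<close> to it is the sum of the squared coordinates in
  \<open>T\<close>. The event then bounds the fraction of the squares carried by
  \<open>T\<close>.\<close>

lemma emeasure_std_gaussian_near_subspace:
  fixes V :: "'a::euclidean_space set"
  assumes V: "subspace V" and d: "0 < dim V" "dim V < DIM('a)" and r: "r \<ge> 0"
  shows "emeasure std_gaussian {g. \<exists>v\<in>V. norm (v - g) \<le> r * norm g}
    = (\<integral>\<^sup>+u. ennreal (beta_density (real (DIM('a) - dim V) / 2) (real (dim V) / 2) u) * indicator {..r\<^sup>2} u \<partial>lborel)"
proof -
  obtain S :: "'a set" where S: "S \<subseteq> Basis" "card S = dim V"
    using d obtain_subset_with_card_n[of "dim V" "Basis :: 'a set"] by (metis less_imp_le)
  have fin: "finite S" using S finite_subset finite_Basis by blast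
  define T where "T = Basis - S"
  have TS: "T \<inter> S = {}" "T \<union> S = Basis" "finite T" using S by (auto simp: T_def)
  have cT: "card T = DIM('a) - dim V" unfolding T_def using S fin by (simp add: card_Diff_subset)
  obtain f where f: "orthogonal_transformation f" "f ` span S = V"
    using orthogonal_transformation_span_Basis[OF V S] .
  note [measurable] = orthogonal_transformation_borel_measurable[OF f(1)]
  have lin: "linear f" using f(1) by (rule orthogonal_transformation_linear)
  let ?E = "{g. \<exists>v\<in>V. norm (v - g) \<le> r * norm g}"
  have "closed {p. snd p \<in> V \<and> norm (snd p - fst p) \<le> r * norm (fst p)}"
  proof (intro closed_Collect_conj closed_Collect_le continuous_intros)
    have "closed (snd -` V)"
      by (intro closed_vimage closed_subspace V continuous_intros)
    then show "closed {p. snd p \<in> V}" by (simp add: vimage_def)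
  qed
  from borel_Ex_closed[of "\<lambda>g v. v \<in> V \<and> norm (v - g) \<le> r * norm g", OF this]
  have [measurable]: "?E \<in> sets borel" by (simp add: Bex_def)
  have mem: "f g \<in> ?E \<longleftrightarrow> (\<Sum>b\<in>T. (g \<bullet> b)\<^sup>2) \<le> r\<^sup>2 * (\<Sum>b\<in>Basis. (g \<bullet> b)\<^sup>2)" for g
  proof -
    have nb: "(norm x)\<^sup>2 = (\<Sum>b\<in>Basis. (x \<bullet> b)\<^sup>2)" for x :: 'a
      by (subst power2_norm_eq_inner, subst euclidean_inner) (simp add: power2_eq_square)
    have le: "norm (w - g) \<le> r * norm g \<longleftrightarrow> (norm (w - g))\<^sup>2 \<le> r\<^sup>2 * (\<Sum>b\<in>Basis. (g \<bullet> b)\<^sup>2)" for w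
      unfolding nb[of g, symmetric] power_mult_distrib[symmetric]
      using r by (simp add: power2_le_iff_abs_le abs_mult)
    have "f g \<in> ?E \<longleftrightarrow> (\<exists>w\<in>span S. norm (f w - f g) \<le> r * norm (f g))"
      unfolding f(2)[symmetric] by auto
    also have "\<dots> \<longleftrightarrow> (\<exists>w\<in>span S. norm (w - g) \<le> r * norm g)"
      by (simp add: orthogonal_transformation_norm[OF f(1)] linear_diff[OF lin, symmetric])
    also have "\<dots> \<longleftrightarrow> (\<Sum>b\<in>T. (g \<bullet> b)\<^sup>2) \<le> r\<^sup>2 * (\<Sum>b\<in>Basis. (g \<bullet> b)\<^sup>2)"
    proof
      assume "\<exists>w\<in>span S. norm (w - g) \<le> r * norm g"
      then obtain w where w: "w \<in> span S" and *: "(norm (w - g))\<^sup>2 \<le> r\<^sup>2 * (\<Sum>b\<in>Basis. (g \<bullet> b)\<^sup>2)"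
        using le by blast
      \<comment> \<open>Vectors of \<open>span S\<close> have zero coordinates in \<open>T\<close>,
        so there \<open>w - g\<close> agrees with \<open>g\<close> up to sign.\<close>
      have "(\<Sum>b\<in>T. (g \<bullet> b)\<^sup>2) = (\<Sum>b\<in>T. ((w - g) \<bullet> b)\<^sup>2)"
        using w unfolding span_substd_basis[OF S(1)] T_def
        by (intro sum.cong) (auto simp: inner_diff_left)
      also have "\<dots> \<le> (\<Sum>b\<in>Basis. ((w - g) \<bullet> b)\<^sup>2)"
        by (intro sum_mono2) (auto simp: T_def)
      also have "\<dots> = (norm (w - g))\<^sup>2" by (simp only: nb)
      finally show "(\<Sum>b\<in>T. (g \<bullet> b)\<^sup>2) \<le> r\<^sup>2 * (\<Sum>b\<in>Basis. (g \<bullet> b)\<^sup>2)" using * by simp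
    next
      assume *: "(\<Sum>b\<in>T. (g \<bullet> b)\<^sup>2) \<le> r\<^sup>2 * (\<Sum>b\<in>Basis. (g \<bullet> b)\<^sup>2)"
      \<comment> \<open>The orthogonal projection of \<open>g\<close> onto \<open>span S\<close> is
        the nearest point.\<close>
      define w where "w = (\<Sum>b\<in>S. (g \<bullet> b) *\<^sub>R b)"
      have w: "w \<in> span S" unfolding w_def by (intro span_sum span_scale span_base)
      have wb: "w \<bullet> b = (if b \<in> S then g \<bullet> b else 0)" if "b \<in> Basis" for b
      proof -
        have "w \<bullet> b = (\<Sum>c\<in>S. if b = c then g \<bullet> b else 0)"
          unfolding w_def inner_sum_left using S(1) that
          by (intro sum.cong) (auto simp: inner_Basis subset_iff)
        then show ?thesis using fin by simp
      qed
      have "(norm (w - g))\<^sup>2 = (\<Sum>b\<in>Basis. ((w - g) \<bullet> b)\<^sup>2)" by (rule nb)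
      also have "\<dots> = (\<Sum>b\<in>T. (g \<bullet> b)\<^sup>2)"
        unfolding T_def
        by (rule sum.mono_neutral_cong_right) (auto simp: inner_diff_left wb)
      finally have "norm (w - g) \<le> r * norm g" unfolding le using * by simp
      with w show "\<exists>w\<in>span S. norm (w - g) \<le> r * norm g" by blast
    qed
    finally show ?thesis .
  qed
  let ?Q = "PiM (T \<union> S) (\<lambda>_. std_normal)"
  let ?X = "{x \<in> space ?Q. (\<Sum>b\<in>T. (x b)\<^sup>2) \<le> r\<^sup>2 * (\<Sum>b\<in>T \<union> S. (x b)\<^sup>2)}"
  have sp: "space ?Q = space (PiM (T \<union> S) (\<lambda>_. borel))" by (simp add: space_PiM)
  have [measurable]: "?X \<in> sets (PiM (T \<union> S) (\<lambda>_. borel))"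
    unfolding sp using fin TS(3) by measurable
  have "emeasure std_gaussian ?E = emeasure (distr std_gaussian borel f) ?E"
    by (simp add: distr_std_gaussian_orthogonal[OF f(1)])
  also have "\<dots> = emeasure std_gaussian (f -` ?E)" by (subst emeasure_distr) auto
  also have "f -` ?E = (\<lambda>x. \<lambda>b\<in>T \<union> S. x \<bullet> id b) -` ?X"
  proof (rule set_eqI)
    fix g
    have eq: "(\<Sum>b\<in>T. ((\<lambda>b\<in>T \<union> S. g \<bullet> id b) b)\<^sup>2) = (\<Sum>b\<in>T. (g \<bullet> b)\<^sup>2)"
      "(\<Sum>b\<in>T \<union> S. ((\<lambda>b\<in>T \<union> S. g \<bullet> id b) b)\<^sup>2) = (\<Sum>b\<in>Basis. (g \<bullet> b)\<^sup>2)"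
      using TS(2) by (auto intro!: sum.cong)
    have "(\<lambda>b\<in>T \<union> S. g \<bullet> id b) \<in> space ?Q" by (simp add: space_PiM)
    then show "g \<in> f -` ?E \<longleftrightarrow> g \<in> (\<lambda>x. \<lambda>b\<in>T \<union> S. x \<bullet> id b) -` ?X"
      unfolding vimage_eq mem by (simp only: mem_Collect_eq eq simp_thms)
  qed
  also have "emeasure std_gaussian \<dots> = emeasure (distr std_gaussian (PiM (T \<union> S) (\<lambda>_. borel)) (\<lambda>x. \<lambda>b\<in>T \<union> S. x \<bullet> id b)) ?X"
    by (subst emeasure_distr) auto
  also have "\<dots> = emeasure ?Q ?X"
    using TS(2) by (subst std_gaussian_coordinates) auto
  also have "\<dots> = (\<integral>\<^sup>+u. ennreal (beta_density (card T / 2) (card S / 2) u) * indicator {..r\<^sup>2} u \<partial>lborel)"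
    using TS fin d cT S by (intro emeasure_std_normal_ratio) auto
  finally show ?thesis by (simp only: cT S(2))
qed

section \<open>Distance from a fixed vector to the range of a Gaussian matrix\<close>

lemma linear_matrix_matrix_mult:
  fixes Q :: "real^'n^'m"
  shows "linear (\<lambda>B :: real^'d^'n. Q ** B)"
  by (intro linearI)
     (simp_all add: vec_eq_iff matrix_matrix_mult_def sum_distrib_left sum.distrib algebra_simps)

text \<open>The probability is the same for all nonzero \<open>c\<close>, hence equal to its average
  over a Gaussian vector \<open>g\<close>. Exchanging the integrals fixes \<open>B\<close> instead,
  and the range of \<open>B\<close> is almost surely a subspace of dimension
  \<open>CARD('d)\<close>.\<close>

lemma emeasure_std_gaussian_matrix_near:
  fixes c :: "real^'e"
  assumes de: "CARD('d) < CARD('e)" and c: "c \<noteq> 0" and r: "r \<ge> 0"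
  shows "emeasure (std_gaussian :: (real^'d^'e) measure) {B. \<exists>y. norm (B *v y - c) \<le> r * norm c}
    = (\<integral>\<^sup>+u. ennreal (beta_density (real (CARD('e) - CARD('d)) / 2) (real CARD('d) / 2) u) * indicator {..r\<^sup>2} u \<partial>lborel)"
    (is "_ = ?I")
proof -
  define E :: "real^'e \<Rightarrow> (real^'d^'e) set" where "E g = {B. \<exists>y. norm (B *v y - g) \<le> r * norm g}" for g
  define S :: "((real^'e) \<times> (real^'d^'e)) set" where "S = {p. snd p \<in> E (fst p)}"
  have [measurable]: "S \<in> sets borel"
    unfolding S_def E_def mem_Collect_eq
    by (intro borel_Ex_closed closed_Collect_le continuous_intros)
  have E_sets [measurable]: "E g \<in> sets borel" for g
    unfolding E_def by (intro borel_Ex_closed closed_Collect_le continuous_intros)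
  \<comment> \<open>The range of \<open>B\<close> is closed under scaling and the tolerance is
    relative to the norm, so only the direction of \<open>g\<close> matters.\<close>
  have scale_sub: "E (t *\<^sub>R g) \<subseteq> E g" if "t > 0" for t g
  proof
    fix B assume "B \<in> E (t *\<^sub>R g)"
    then obtain y where y: "norm (B *v y - t *\<^sub>R g) \<le> r * norm (t *\<^sub>R g)" by (auto simp: E_def)
    have "B *v y - t *\<^sub>R g = t *\<^sub>R (B *v ((1 / t) *\<^sub>R y) - g)"
      using that by (simp add: matrix_vector_mult_scaleR scaleR_diff_right)
    with y that have "t * norm (B *v ((1 / t) *\<^sub>R y) - g) \<le> t * (r * norm g)" by (simp add: mult_ac)
    with that have "norm (B *v ((1 / t) *\<^sub>R y) - g) \<le> r * norm g" by simp
    then show "B \<in> E g" unfolding E_def by blast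
  qed
  have scale: "E (t *\<^sub>R g) = E g" if "t > 0" for t g
    using scale_sub[OF that, of g] scale_sub[of "1 / t" "t *\<^sub>R g"] that by auto
  have const: "emeasure std_gaussian (E g) = emeasure std_gaussian (E c)" if g: "g \<noteq> 0" for g
  proof -
    \<comment> \<open>Rescaling \<open>g\<close> to the norm of \<open>c\<close> allows an
      orthogonal \<open>h\<close> with \<open>h c = t *\<^sub>R g\<close>; left multiplication by
      its matrix preserves the Gaussian law.\<close>
    define t where "t = norm c / norm g"
    have t: "t > 0" using c g by (simp add: t_def)
    have "norm c = norm (t *\<^sub>R g)" using g by (simp add: t_def)
    then obtain h where h: "orthogonal_transformation h" "h c = t *\<^sub>R g"
      by (rule orthogonal_transformation_exists)
    have lin: "linear h" using h(1) by (rule orthogonal_transformation_linear)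
    have mh: "matrix h *v x = h x" for x using lin by simp
    define F :: "real^'d^'e \<Rightarrow> real^'d^'e" where "F B = matrix h ** B" for B
    have "linear F"
      unfolding F_def by (rule linear_matrix_matrix_mult)
    moreover have "F B \<bullet> F C = B \<bullet> C" for B C
      using h(1) by (simp add: F_def inner_matrix_columns column_matrix_matrix_mult mh orthogonal_transformation_def)
    ultimately have F: "orthogonal_transformation F" by (simp add: orthogonal_transformation_def)
    note [measurable] = orthogonal_transformation_borel_measurable[OF F]
    have "F B \<in> E (t *\<^sub>R g) \<longleftrightarrow> B \<in> E c" for B
    proof -
      have "norm (F B *v y - t *\<^sub>R g) = norm (B *v y - c)" for y
        by (simp add: F_def matrix_vector_mul_assoc[symmetric] mh h(2)[symmetric]
             linear_diff[OF lin, symmetric] orthogonal_transformation_norm[OF h(1)])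
      moreover have "norm (t *\<^sub>R g) = norm c" by (simp add: h(2)[symmetric] orthogonal_transformation_norm[OF h(1)])
      ultimately show ?thesis by (simp only: E_def mem_Collect_eq)
    qed
    then have "F -` E (t *\<^sub>R g) = E c" by auto
    moreover have "emeasure std_gaussian (E g) = emeasure (distr std_gaussian borel F) (E (t *\<^sub>R g))"
      by (simp add: distr_std_gaussian_orthogonal[OF F] scale[OF t])
    moreover have "\<dots> = emeasure std_gaussian (F -` E (t *\<^sub>R g))"
      by (subst emeasure_distr) auto
    ultimately show ?thesis by simp
  qed
  have "AE g in (std_gaussian :: (real^'e) measure). g \<notin> {0}"
    by (intro AE_not_in null_setsI emeasure_std_gaussian_negligible) auto
  then have ne: "AE g in (std_gaussian :: (real^'e) measure). g \<noteq> 0" by simp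
  have "emeasure std_gaussian (E c) = (\<integral>\<^sup>+g. emeasure std_gaussian (E c) \<partial>(std_gaussian :: (real^'e) measure))"
    by (simp add: std_gaussian.emeasure_space_1[simplified])
  also have "\<dots> = (\<integral>\<^sup>+g. emeasure std_gaussian (E g) \<partial>(std_gaussian :: (real^'e) measure))"
    by (rule nn_integral_cong_AE) (use ne in eventually_elim, simp add: const)
  also have "\<dots> = (\<integral>\<^sup>+g. \<integral>\<^sup>+B. indicator S (g, B) \<partial>(std_gaussian :: (real^'d^'e) measure) \<partial>(std_gaussian :: (real^'e) measure))"
  proof (rule nn_integral_cong)
    fix g
    have "(indicator S (g, B) :: ennreal) = indicator (E g) B" for B by (simp add: S_def indicator_def)
    then show "emeasure std_gaussian (E g) = (\<integral>\<^sup>+B. indicator S (g, B) \<partial>(std_gaussian :: (real^'d^'e) measure))" by simp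
  qed
  also have "\<dots> = (\<integral>\<^sup>+B. \<integral>\<^sup>+g. indicator S (g, B) \<partial>(std_gaussian :: (real^'e) measure) \<partial>(std_gaussian :: (real^'d^'e) measure))"
  proof (rule pair_sigma_finite.Fubini'[symmetric])
    show "pair_sigma_finite (std_gaussian :: (real^'e) measure) (std_gaussian :: (real^'d^'e) measure)"
      by (intro pair_sigma_finite.intro std_gaussian.sigma_finite_measure_axioms)
    have "indicator S \<in> borel_measurable (borel :: ((real^'e) \<times> (real^'d^'e)) measure)" by measurable
    then show "(\<lambda>(g, B). indicator S (g, B) :: ennreal) \<in>
        borel_measurable ((std_gaussian :: (real^'e) measure) \<Otimes>\<^sub>M (std_gaussian :: (real^'d^'e) measure))"
      by (simp add: std_gaussian_prod case_prod_beta)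
  qed
  also have "\<dots> = (\<integral>\<^sup>+B. ?I \<partial>(std_gaussian :: (real^'d^'e) measure))"
  proof (rule nn_integral_cong_AE)
    show "AE B in (std_gaussian :: (real^'d^'e) measure).
        (\<integral>\<^sup>+g. indicator S (g, B) \<partial>(std_gaussian :: (real^'e) measure)) = ?I"
      using AE_std_gaussian_inj[where 'd = 'd and 'n = 'e, OF less_imp_le[OF de]]
    proof eventually_elim
      case (elim B)
      have sub: "subspace (range ((*v) B))"
        by (intro linear_subspace_image) (auto simp: subspace_UNIV)
      have dim: "dim (range ((*v) B)) = CARD('d)"
        using elim by (simp add: full_rank_injective[symmetric] rank_dim_range)
      have "(\<integral>\<^sup>+g. indicator S (g, B) \<partial>(std_gaussian :: (real^'e) measure))
         = (\<integral>\<^sup>+g. indicator ((\<lambda>g. (g, B)) -` S) g \<partial>(std_gaussian :: (real^'e) measure))"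
        by (simp add: indicator_def)
      also have "\<dots> = emeasure std_gaussian ((\<lambda>g. (g, B)) -` S)"
      proof (rule nn_integral_indicator)
        have "(\<lambda>g. (g, B)) \<in> borel_measurable borel"
          by (intro borel_measurable_continuous_onI continuous_intros)
        then show "(\<lambda>g. (g, B)) -` S \<in> sets std_gaussian"
          by (auto intro: measurable_sets_borel)
      qed
      also have "(\<lambda>g. (g, B)) -` S = {g. \<exists>v\<in>range ((*v) B). norm (v - g) \<le> r * norm g}"
        by (auto simp: S_def E_def)
      also have "emeasure std_gaussian \<dots> = ?I"
        using emeasure_std_gaussian_near_subspace[OF sub _ _ r] de by (simp add: dim)
      finally show ?case .
    qed
  qed
  also have "\<dots> = ?I" by (simp add: std_gaussian.emeasure_space_1[simplified])
  finally show ?thesis by (simp add: E_def)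
qed

section \<open>Random embeddings\<close>

text \<open>With \<open>a = (N - d) / 2\<close> and \<open>b = d / 2\<close> the binomial factor is
  \<open>1 / (a * Beta a b)\<close>. For \<open>d = 1\<close> the bound is in fact an equality; for
  \<open>d > 1\<close> one has \<open>b \<ge> 1\<close> and the monotonicity bound applies.\<close>

lemma tau_le_beta:
  assumes r: "0 < r" "r < 1" and d: "1 \<le> d" "d < N"
  shows "ennreal (tau r d N)
    \<le> (\<integral>\<^sup>+u. ennreal (beta_density (real (N - d) / 2) (real d / 2) u) * indicator {..r\<^sup>2} u \<partial>lborel)"
proof -
  define a b where "a = real (N - d) / 2" and "b = real d / 2"
  have a: "a > 0" and b: "b > 0" using d by (auto simp: a_def b_def)
  have ab: "(real N - 2) / 2 + 1 = a + b" "(real N - real d) / 2 = a" "(real N - 2) / 2 - a + 1 = b"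
    using d by (auto simp: a_def b_def of_nat_diff field_simps)
  have "Gamma (a + 1) = a * Gamma a" using a by (intro Gamma_plus1) auto
  then have rb: "real_binomial ((real N - 2) / 2) a = 1 / (a * Beta a b)"
    unfolding real_binomial_def ab by (simp add: Beta_def)
  show ?thesis
  proof (cases "d = 1")
    case True
    \<comment> \<open>The prefactor \<open>N - 1\<close> cancels the \<open>a\<close> in the
      denominator and leaves the 2 produced by the sine substitution.\<close>
    have "real N - 1 = 2 * a" using True d by (simp add: a_def of_nat_diff)
    then have "(real N - 1) * real_binomial ((real N - 2) / 2) ((real N - 1) / 2) = 2 / Beta a b"
      using rb a by simp
    then have "tau r d N = 2 / Beta a b * integral {0..arcsin r} (\<lambda>x. sin x ^ (N - 2))"
      using True by (simp add: tau_def)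
    then show ?thesis
      using nn_integral_beta_half_arcsin[OF r, of N] d True by (simp add: a_def b_def)
  next
    case False
    have "tau r d N = (r\<^sup>2) powr a * (1 - r\<^sup>2) powr (b - 1) / (a * Beta a b)"
    proof -
      have "r\<^sup>2 = r powr 2" using r by simp
      then have "(r\<^sup>2) powr a = r powr real (N - d)"
        by (simp only: powr_powr) (simp add: a_def)
      then have "r ^ (N - d) = (r\<^sup>2) powr a" using r by (simp add: powr_realpow)
      moreover have "(real d - 2) / 2 = b - 1" by (simp add: b_def diff_divide_distrib)
      moreover have "tau r d N = real_binomial ((real N - 2) / 2) a * r ^ (N - d) * (1 - r\<^sup>2) powr ((real d - 2) / 2)"
        using False by (simp only: tau_def if_False ab(2))
      ultimately show ?thesis by (simp only: rb) simp
    qed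
    moreover have "r\<^sup>2 < 1" using r by (simp add: power_less_one_iff)
    ultimately show ?thesis
      using nn_integral_beta_density_lower_bound[of a b "r\<^sup>2"] a r False d by (simp add: a_def b_def)
  qed
qed

section \<open>From independent entries to the law of the matrix\<close>

text \<open>Independence makes the joint law of the entries a product of standard normals, which is
  also the law of the coordinates under \<open>std_gaussian\<close>. Reassembling the matrix from
  its entries transfers this equality to matrices.\<close>

lemma gaussian_matrix_distr:
  fixes A :: "'a \<Rightarrow> real^'d^'n"
  assumes M: "prob_space M" and A: "gaussian_matrix M A"
  shows "A \<in> borel_measurable M" and "distr M borel A = std_gaussian"
proof -
  interpret M: prob_space M by fact
  define X :: "'n \<times> 'd \<Rightarrow> 'a \<Rightarrow> real" where "X = (\<lambda>(i, j) \<omega>. A \<omega> $ i $ j)"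
  define \<beta> :: "'n \<times> 'd \<Rightarrow> real^'d^'n" where "\<beta> = (\<lambda>(i, j). axis i (axis j 1))"
  have inner_\<beta>: "x \<bullet> \<beta> p = x $ fst p $ snd p" for x p
    by (cases p) (simp add: \<beta>_def inner_axis)
  have \<beta>: "bij_betw \<beta> UNIV Basis"
    unfolding bij_betw_def
    by (auto simp: inj_on_def \<beta>_def Basis_vec_def axis_eq_axis)
  have dist: "distributed M lborel (X p) std_normal_density" for p
    using A by (cases p) (auto simp: gaussian_matrix_def X_def)
  have rv [measurable]: "X p \<in> borel_measurable M" for p
    using distributed_measurable[OF dist] by simp
  have "distr M borel (X p) = distr M lborel (X p)" for p
    by (rule distr_cong) auto
  then have law: "distr M borel (X p) = std_normal" for p
    using distributed_distr_eq_density[OF dist] by simp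
  have "A \<omega> \<bullet> \<beta> p = X p \<omega>" for \<omega> p by (cases p) (simp add: inner_\<beta> X_def)
  then have "(\<lambda>\<omega>. A \<omega> \<bullet> \<beta> p) \<in> borel_measurable M" for p by simp
  then show Am [measurable]: "A \<in> borel_measurable M"

    by (subst borel_measurable_euclidean_space) (auto simp flip: bij_betw_imp_surj_on[OF \<beta>])
  \<comment> \<open>A measurable inverse of the map taking a matrix to its family of
    entries.\<close>
  define R :: "('n \<times> 'd \<Rightarrow> real) \<Rightarrow> real^'d^'n" where "R h = (\<chi> i j. h (i, j))" for h
  have [measurable]: "R \<in> borel_measurable (PiM UNIV (\<lambda>_. borel))"
  proof -
    have "R h \<bullet> \<beta> p = h p" for h p by (cases p) (simp add: inner_\<beta> R_def)
    then have "(\<lambda>h. R h \<bullet> \<beta> p) \<in> borel_measurable (PiM UNIV (\<lambda>_. borel))" for p by simp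
    then show ?thesis

    by (subst borel_measurable_euclidean_space) (auto simp flip: bij_betw_imp_surj_on[OF \<beta>])
  qed
  have indep: "M.indep_vars (\<lambda>_. borel) X UNIV"
    using A by (simp add: gaussian_matrix_def X_def)
  have "distr M (PiM UNIV (\<lambda>_. borel)) (\<lambda>\<omega>. \<lambda>p\<in>UNIV. X p \<omega>) = PiM UNIV (\<lambda>p. distr M borel (X p))"
    by (rule iffD1[OF M.indep_vars_iff_distr_eq_PiM indep]) auto
  also have "\<dots> = distr std_gaussian (PiM UNIV (\<lambda>_. borel)) (\<lambda>x. \<lambda>p\<in>UNIV. x \<bullet> \<beta> p)"
    unfolding law by (rule std_gaussian_coordinates[OF \<beta>, symmetric])
  finally have eq: "distr M (PiM UNIV (\<lambda>_. borel)) (\<lambda>\<omega>. \<lambda>p\<in>UNIV. X p \<omega>)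
      = distr std_gaussian (PiM UNIV (\<lambda>_. borel)) (\<lambda>x. \<lambda>p\<in>UNIV. x \<bullet> \<beta> p)" .
  have "distr M borel A = distr M borel (R \<circ> (\<lambda>\<omega>. \<lambda>p\<in>UNIV. X p \<omega>))"
    by (rule arg_cong[where f = "distr M borel"]) (auto simp: R_def X_def fun_eq_iff vec_eq_iff)
  also have "\<dots> = distr (distr M (PiM UNIV (\<lambda>_. borel)) (\<lambda>\<omega>. \<lambda>p\<in>UNIV. X p \<omega>)) borel R"
    by (rule distr_distr[symmetric]) measurable
  also have "\<dots> = distr std_gaussian borel (R \<circ> (\<lambda>x. \<lambda>p\<in>UNIV. x \<bullet> \<beta> p))"
    unfolding eq by (rule distr_distr) measurable
  also have "\<dots> = distr std_gaussian borel (\<lambda>x. x)"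
    by (rule arg_cong[where f = "distr std_gaussian borel"]) (auto simp: R_def inner_\<beta> fun_eq_iff vec_eq_iff)
  also have "\<dots> = std_gaussian" by (rule distr_id2) simp
  finally show "distr M borel A = std_gaussian" .
qed

section \<open>Reduction to the effective subspace\<close>

lemma transpose_matrix_inner:
  fixes U :: "real^'e^'n"
  shows "(transpose U *v x) \<bullet> z = x \<bullet> (U *v z)"
  by (simp add: dot_lmul_matrix)

lemma norm_orthonormal_columns_mult:
  fixes U :: "real^'e^'n"
  assumes "transpose U ** U = mat 1"
  shows "norm (U *v w) = norm w"
proof -
  have "(U *v w) \<bullet> (U *v w) = (transpose U *v (U *v w)) \<bullet> w"
    by (rule transpose_matrix_inner[symmetric])
  also have "\<dots> = w \<bullet> w" by (simp only: matrix_vector_mul_assoc assms matrix_vector_mul_lid)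
  finally show ?thesis by (simp add: norm_eq_sqrt_inner)
qed

text \<open>Left multiplication by \<open>U\<close> is adjoint to that by \<open>transpose U\<close>
  and is undone by it, so the coisometry result applies to matrix spaces.\<close>

lemma distr_std_gaussian_transpose_mult:
  fixes U :: "real^'e^'n"
  assumes U: "transpose U ** U = mat 1"
  shows "distr (std_gaussian :: (real^'d^'n) measure) borel (\<lambda>X. transpose U ** X) = std_gaussian"
proof (rule distr_std_gaussian_coisometry[where T' = "\<lambda>Z. U ** Z"])
  show "(transpose U ** X) \<bullet> Z = X \<bullet> (U ** Z)" for X :: "real^'d^'n" and Z
    by (simp only: inner_matrix_columns column_matrix_matrix_mult transpose_matrix_inner)
  show "transpose U ** (U ** Z) = Z" for Z :: "real^'d^'e"
    by (simp add: matrix_mul_assoc U)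
qed (rule linear_matrix_matrix_mult)+

text \<open>\<open>U *v (transpose U *v x)\<close> is the orthogonal projection of \<open>x\<close>
  onto the span of the columns; the remainder lies in the complement, along which \<open>f\<close>
  is constant.\<close>

lemma constant_along_complement_project:
  fixes U :: "real^'e^'n"
  assumes U: "transpose U ** U = mat 1" and f: "constant_along_complement f (span (columns U))"
  shows "f (U *v (transpose U *v x)) = f x"
proof -
  let ?x = "U *v (transpose U *v x)"
  have "transpose U *v (x - ?x) = 0"
    by (simp add: matrix_vector_mult_diff_distrib matrix_vector_mul_assoc matrix_mul_assoc U del: transpose_matrix_vector)
  then have 0: "(x - ?x) \<bullet> (U *v w) = 0" for w
    using transpose_matrix_inner[of U "x - ?x" w] by simp
  have "orthogonal (x - ?x) y" if "y \<in> columns U" for y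
    using that 0 by (auto simp: orthogonal_def columns_image_basis)
  then have "orthogonal (x - ?x) y" if "y \<in> span (columns U)" for y
    using orthogonal_to_span that by blast
  then have "x - ?x \<in> orthogonal_comp (span (columns U))"
    by (auto simp: orthogonal_comp_def orthogonal_commute)
  moreover have "?x \<in> span (columns U)"
    by (metis matrix_vector_mult_in_columnspace)
  ultimately have "f (?x + (x - ?x)) = f ?x"
    using f unfolding constant_along_complement_def by blast
  then show ?thesis by simp
qed

theorem corollary7p4:
  fixes f :: "real^'n \<Rightarrow> real"
    and U :: "real^'e^'n"
    and M :: "'a measure"
    and A :: "'a \<Rightarrow> real^'d^'n"
    and p xstar :: "real^'n"
    and L \<epsilon> :: real
  assumes "L > 0" and "L-lipschitz_on UNIV f"
    and "has_effective_dimension f CARD('e)"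
    and "transpose U ** U = mat 1"
    and "effective_subspace f (span (columns U))"
    and "CARD('d) < CARD('e)"
    and "\<epsilon> > 0"
    and "prob_space M" and "gaussian_matrix M A"
    and "\<forall>x. f xstar \<le> f x"
    and "p \<notin> near_minimizers f \<epsilon>"
  shows "measure M {\<omega> \<in> space M. reduced_successful f (A \<omega>) p \<epsilon>}
           \<ge> tau (\<epsilon> / (L * norm (transpose U *v xstar - transpose U *v p))) CARD('d) CARD('e)"
proof -
  note L = assms(1) and lip = assms(2) and U = assms(4) and eps = assms(7)
  interpret M: prob_space M by fact
  note [measurable] = gaussian_matrix_distr(1)[OF assms(8,9)]
  note lawA = gaussian_matrix_distr(2)[OF assms(8,9)]
  have minv: "min_value f = f xstar"
    unfolding min_value_def by (rule Least_equality) (use assms(10) in auto)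
  have cac: "constant_along_complement f (span (columns U))"
    using assms(5) by (simp add: effective_subspace_def)
  \<comment> \<open>Projecting both points first leaves \<open>f\<close> unchanged, and
    \<open>U\<close> is an isometry, so the Lipschitz bound holds in the reduced
    coordinates.\<close>
  have bound: "\<bar>f x - f y\<bar> \<le> L * norm (transpose U *v x - transpose U *v y)" for x y
  proof -
    have "\<bar>f x - f y\<bar> = dist (f (U *v (transpose U *v x))) (f (U *v (transpose U *v y)))"
      by (simp only: constant_along_complement_project[OF U cac] dist_real_def)
    also have "\<dots> \<le> L * dist (U *v (transpose U *v x)) (U *v (transpose U *v y))"
      by (rule lipschitz_onD[OF lip]) auto
    also have "dist (U *v (transpose U *v x)) (U *v (transpose U *v y)) = norm (transpose U *v x - transpose U *v y)"
      by (simp only: dist_norm matrix_vector_mult_diff_distrib[symmetric] norm_orthonormal_columns_mult[OF U])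
    finally show ?thesis .
  qed
  define c where "c = transpose U *v xstar - transpose U *v p"
  define r where "r = \<epsilon> / (L * norm c)"
  \<comment> \<open>That \<open>p\<close> is not a near minimizer forces \<open>c \<noteq> 0\<close>
    and \<open>r < 1\<close>, the range in which \<open>tau\<close> is meaningful.\<close>
  have "\<epsilon> < f p - f xstar"
    using assms(11) by (simp add: near_minimizers_def minv)
  also have "\<dots> \<le> L * norm c"
    using bound[of xstar p] by (simp add: c_def)
  finally have lt: "\<epsilon> < L * norm c" .
  have c: "c \<noteq> 0" using lt eps by auto
  have r: "0 < r" "r < 1" using lt eps by (auto simp: r_def)
  have rc: "r * norm c = \<epsilon> / L" using c L by (simp add: r_def)
  \<comment> \<open>\<open>S\<close> collects the matrices with a successful reduced problem, and
    \<open>E\<close> the smaller matrices whose range comes within \<open>r * norm c\<close>, that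
    is \<open>\<epsilon> / L\<close>, of \<open>c\<close>. The former is Borel because
    \<open>f\<close> is continuous.\<close>
  define S :: "(real^'d^'n) set" where "S = {X. \<exists>y. f (X *v y + p) \<le> f xstar + \<epsilon>}"
  define E :: "(real^'d^'e) set" where "E = {B. \<exists>y. norm (B *v y - c) \<le> r * norm c}"
  have contf: "continuous_on UNIV f" using lip by (rule lipschitz_on_continuous_on)
  have "continuous_on UNIV (\<lambda>q :: (real^'d^'n) \<times> (real^'d). f (fst q *v snd q + p))"
  proof (rule continuous_on_compose2[OF contf])
    show "continuous_on UNIV (\<lambda>q :: (real^'d^'n) \<times> (real^'d). fst q *v snd q + p)"
      by (intro continuous_intros)
  qed simp
  then have "closed {q :: (real^'d^'n) \<times> (real^'d). f (fst q *v snd q + p) \<le> f xstar + \<epsilon>}"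
    by (intro closed_Collect_le continuous_on_const)
  from borel_Ex_closed[of "\<lambda>X y. f (X *v y + p) \<le> f xstar + \<epsilon>", OF this]
  have S_sets [measurable]: "S \<in> sets borel" by (simp add: S_def)
  have E_sets [measurable]: "E \<in> sets borel"
    unfolding E_def by (intro borel_Ex_closed closed_Collect_le continuous_intros)
  have Tm [measurable]: "(\<lambda>X :: real^'d^'n. transpose U ** X) \<in> borel_measurable borel"
    by (intro borel_measurable_continuous_onI linear_continuous_on)
       (use linear_matrix_matrix_mult linear_conv_bounded_linear in blast)
  have sub: "(\<lambda>X. transpose U ** X) -` E \<subseteq> S"
  proof
    fix X assume "X \<in> (\<lambda>X. transpose U ** X) -` E"
    then obtain y where y: "norm ((transpose U ** X) *v y - c) \<le> \<epsilon> / L"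
      by (auto simp: E_def rc)
    \<comment> \<open>In reduced coordinates the displacement from the minimizer is the residual of
      approximating \<open>c\<close> by the range of \<open>transpose U ** X\<close>.\<close>
    have "transpose U *v (X *v y + p) - transpose U *v xstar = (transpose U ** X) *v y - c"
      by (simp only: c_def matrix_vector_right_distrib matrix_vector_mul_assoc) simp
    then have "\<bar>f (X *v y + p) - f xstar\<bar> \<le> L * norm ((transpose U ** X) *v y - c)"
      using bound[of "X *v y + p" xstar] by (simp only:)
    also have "\<dots> \<le> \<epsilon>" using y L by (simp add: field_simps)
    finally show "X \<in> S" unfolding S_def by (auto intro!: exI[of _ y])
  qed
  have "ennreal (tau r CARD('d) CARD('e)) \<le> emeasure std_gaussian E"
    unfolding E_def emeasure_std_gaussian_matrix_near[OF assms(6) c less_imp_le[OF r(1)]]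
    using assms(6) by (intro tau_le_beta r) (auto simp: Suc_le_eq)
  also have "\<dots> = emeasure (distr (std_gaussian :: (real^'d^'n) measure) borel (\<lambda>X. transpose U ** X)) E"
    by (simp only: distr_std_gaussian_transpose_mult[OF U])
  also have "\<dots> = emeasure (std_gaussian :: (real^'d^'n) measure) ((\<lambda>X. transpose U ** X) -` E)"
    by (subst emeasure_distr) auto
  also have "\<dots> \<le> emeasure (distr M borel A) S"
    unfolding lawA using sub by (rule emeasure_mono) simp
  also have "\<dots> = emeasure M {\<omega> \<in> space M. reduced_successful f (A \<omega>) p \<epsilon>}"
  proof -
    have "A -` S \<inter> space M = {\<omega> \<in> space M. reduced_successful f (A \<omega>) p \<epsilon>}"
      by (auto simp: S_def reduced_successful_def minv)
    then show ?thesis by (simp add: emeasure_distr)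
  qed
  also have "\<dots> = ennreal (measure M {\<omega> \<in> space M. reduced_successful f (A \<omega>) p \<epsilon>})"
    by (rule M.emeasure_eq_measure)
  finally show ?thesis
    by (simp add: r_def c_def)
qed

end
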